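(* Let $\mathcal H$ be a complex Hilbert space and let $A=N+K$, where $N$ is a bounded normal operator on $\mathcal H$ and $K$ is a compact operator on $\mathcal H$. If $W(A)\subset\overline{\mathbb D}$, the intersection $\mathbb T\cap\overline{W(A)}$ is infinite, and $\sigma_{ess}(A)\subset\mathbb D$, then $W(A)=\overline{\mathbb D}$.
   Context: All operators are bounded linear operators on a complex Hilbert space $\mathcal H$. The numerical range of $A$ is $W(A)=\{\langle Ax,x\rangle : x\in\mathcal H,\ \|x\|=1\}$, and $\overline{W(A)}$ is its closure in $\mathbb C$. $\mathbb D=\{z\in\mathbb C: |z|<1\}$ is the open unit disk, $\overline{\mathbb D}$ the closed unit disk, and $\mathbb T=\partial\mathbb D$ the unit circle. The essential spectrum $\sigma_{ess}(A)$ is the set of $\lambda\in\mathbb C$ such that $A-\lambda I$ is not Fredholm (equivalently, the spectrum of the class of $A$ in the Calkin algebra). *)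

theory Defs
  imports "HOL-Analysis.Analysis"
begin

text \<open>The inner product \<open>cinner\<close> is linear in its first argument. The real Hilbert space
  structure underlying a complex Hilbert space is made available through the superclass
  \<^class>\<open>real_inner\<close>: its inner product is the real part of \<open>cinner\<close>, so that
  \<open>norm x = sqrt (Re (cinner x x))\<close>.\<close>

class complex_hilbert = real_inner + complete_space +
  fixes scaleC :: "complex \<Rightarrow> 'a \<Rightarrow> 'a" (infixr \<open>*\<^sub>C\<close> 75)
    and cinner :: "'a \<Rightarrow> 'a \<Rightarrow> complex"
  assumes scaleC_add_right: "a *\<^sub>C (x + y) = a *\<^sub>C x + a *\<^sub>C y"
    and scaleC_add_left: "(a + b) *\<^sub>C x = a *\<^sub>C x + b *\<^sub>C x"
    and scaleC_scaleC: "a *\<^sub>C b *\<^sub>C x = (a * b) *\<^sub>C x"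
    and scaleC_one: "1 *\<^sub>C x = x"
    and scaleR_eq_scaleC: "r *\<^sub>R x = complex_of_real r *\<^sub>C x"
    and cinner_commute: "cinner x y = cnj (cinner y x)"
    and cinner_add_left: "cinner (x + y) z = cinner x z + cinner y z"
    and cinner_scaleC_left: "cinner (a *\<^sub>C x) y = a * cinner x y"
    and inner_eq_Re_cinner: "inner x y = Re (cinner x y)"

instantiation complex :: complex_hilbert
begin

definition scaleC_complex_def: "a *\<^sub>C x = a * (x :: complex)"

definition cinner_complex_def: "cinner x y = x * cnj (y :: complex)"

instance
  by standard (simp_all add: scaleC_complex_def cinner_complex_def algebra_simps
      scaleR_conv_of_real inner_complex_def)

end

global_interpretation complex_vector: vector_space "scaleC :: complex \<Rightarrow> 'a \<Rightarrow> 'a::complex_hilbert"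
  defines cspan = complex_vector.span
  by standard (simp_all add: scaleC_add_right scaleC_add_left scaleC_scaleC scaleC_one)

lemma cinner_self: "cinner x x = complex_of_real ((norm x)\<^sup>2)"
  for x :: "'a::complex_hilbert"
proof (rule complex_eqI)
  show "Re (cinner x x) = Re (complex_of_real ((norm x)\<^sup>2))"
    by (simp add: power2_norm_eq_inner inner_eq_Re_cinner)
  show "Im (cinner x x) = Im (complex_of_real ((norm x)\<^sup>2))"
    using arg_cong[OF cinner_commute[of x x], of Im] by simp
qed

definition bounded_clinear :: "('a::complex_hilbert \<Rightarrow> 'a) \<Rightarrow> bool" where
  "bounded_clinear T \<longleftrightarrow> bounded_linear T \<and> (\<forall>a x. T (a *\<^sub>C x) = a *\<^sub>C T x)"

definition cadjoint :: "('a::complex_hilbert \<Rightarrow> 'a) \<Rightarrow> 'a \<Rightarrow> 'a" where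
  "cadjoint T = (SOME S. \<forall>x y. cinner (T x) y = cinner x (S y))"

definition normal_operator :: "('a::complex_hilbert \<Rightarrow> 'a) \<Rightarrow> bool" where
  "normal_operator T \<longleftrightarrow> bounded_clinear T \<and> T \<circ> cadjoint T = cadjoint T \<circ> T"

definition compact_operator :: "('a::complex_hilbert \<Rightarrow> 'a) \<Rightarrow> bool" where
  "compact_operator T \<longleftrightarrow> bounded_clinear T \<and> compact (closure (T ` cball 0 1))"

definition fredholm :: "('a::complex_hilbert \<Rightarrow> 'a) \<Rightarrow> bool" where
  "fredholm T \<longleftrightarrow> bounded_clinear T
     \<and> (\<exists>B. finite B \<and> {x. T x = 0} \<subseteq> cspan B)
     \<and> closed (range T)
     \<and> (\<exists>B. finite B \<and> cspan (range T \<union> B) = UNIV)"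

definition essential_spectrum :: "('a::complex_hilbert \<Rightarrow> 'a) \<Rightarrow> complex set" where
  "essential_spectrum T = {z. \<not> fredholm (\<lambda>x. T x - z *\<^sub>C x)}"

definition numerical_range :: "('a::complex_hilbert \<Rightarrow> 'a) \<Rightarrow> complex set" where
  "numerical_range T = {cinner (T x) x | x. norm x = 1}"

lemma riesz_representation_real:
  fixes f :: "'a::{real_inner, complete_space} \<Rightarrow> real"
  assumes f: "bounded_linear f"
  shows "\<exists>v. \<forall>x. f x = inner v x"
proof -
  interpret bounded_linear f by (rule f)
  define \<phi> where "\<phi> x = inner x x - 2 * f x" for x
  obtain C where C: "\<And>x. norm (f x) \<le> norm x * C" using bounded by blast
  have lower: "- C\<^sup>2 \<le> \<phi> x" for x
  proof -
    have "f x \<le> norm x * C" using C[of x] by (simp add: abs_le_iff)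
    moreover have "0 \<le> (norm x - C)\<^sup>2" by simp
    ultimately show ?thesis
      unfolding \<phi>_def power2_norm_eq_inner[symmetric] by (simp add: power2_diff)
  qed
  then have bdd: "bdd_below (range \<phi>)" by (meson bdd_belowI2)
  define m where "m = Inf (range \<phi>)"
  have m_le: "m \<le> \<phi> x" for x unfolding m_def by (rule cINF_lower[OF bdd]) simp
  have "\<exists>x. \<phi> x < m + inverse (real (Suc n))" for n
  proof -
    have "Inf (range \<phi>) < m + inverse (real (Suc n))" unfolding m_def by simp
    then show ?thesis using cInf_lessD[of "range \<phi>"] by blast
  qed
  then obtain X where X: "\<And>n. \<phi> (X n) < m + inverse (real (Suc n))" by metis
  have par: "inner (x - y) (x - y) \<le> 2 * (\<phi> x - m) + 2 * (\<phi> y - m)" for x y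
  proof -
    have "inner (x - y) (x - y) = 2 * \<phi> x + 2 * \<phi> y - 4 * \<phi> ((1/2) *\<^sub>R (x + y))"
      unfolding \<phi>_def by (simp add: scale add inner_simps inner_commute algebra_simps)
    moreover have "4 * m \<le> 4 * \<phi> ((1/2) *\<^sub>R (x + y))" using m_le by simp
    ultimately show ?thesis by argo
  qed
  have "Cauchy X"
  proof (rule metric_CauchyI)
    fix e :: real assume "0 < e"
    then obtain M where M: "inverse (real (Suc M)) < e\<^sup>2 / 4"
      using reals_Archimedean[of "e\<^sup>2 / 4"] by auto
    have small: "\<phi> (X n) - m < e\<^sup>2 / 4" if "n \<ge> M" for n
    proof -
      have "inverse (real (Suc n)) \<le> inverse (real (Suc M))"
        using that by (intro le_imp_inverse_le) auto
      with X[of n] M show ?thesis by linarith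
    qed
    have "dist (X i) (X j) < e" if "i \<ge> M" "j \<ge> M" for i j
    proof -
      have "(norm (X i - X j))\<^sup>2 < e\<^sup>2"
        using par[of "X i" "X j"] small[OF that(1)] small[OF that(2)]
        unfolding power2_norm_eq_inner by argo
      then show ?thesis
        using \<open>0 < e\<close> power_less_imp_less_base[of "norm (X i - X j)" 2 e] by (simp add: dist_norm)
    qed
    then show "\<exists>M. \<forall>i\<ge>M. \<forall>j\<ge>M. dist (X i) (X j) < e" by blast
  qed
  then obtain v where v: "X \<longlonglongrightarrow> v"
    using Cauchy_convergent convergent_def by blast
  have "(\<lambda>n. \<phi> (X n)) \<longlonglongrightarrow> \<phi> v"
    unfolding \<phi>_def by (intro tendsto_intros v tendsto)
  moreover have "(\<lambda>n. m + inverse (real (Suc n))) \<longlonglongrightarrow> m + 0"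
    by (intro tendsto_intros LIMSEQ_inverse_real_of_nat)
  ultimately have "\<phi> v \<le> m + 0"
    by (rule LIMSEQ_le) (intro exI allI impI less_imp_le X)
  then have min: "\<phi> v \<le> \<phi> x" for x using m_le[of x] by linarith
  have "f x = inner v x" for x
  proof (cases "x = 0")
    case False
    define a where "a = inner v x - f x"
    define q where "q = inner x x"
    have q: "q > 0" using False by (simp add: q_def)
    have "\<phi> (v + t *\<^sub>R x) = \<phi> v + 2 * t * a + t\<^sup>2 * q" for t
      unfolding \<phi>_def a_def q_def
      by (simp add: add scale inner_simps inner_commute[of x v] algebra_simps power2_eq_square)
    then have "0 \<le> 2 * t * a + t\<^sup>2 * q" for t using min[of "v + t *\<^sub>R x"] by simp
    from this[of "- a / q"] have "0 \<le> - (a\<^sup>2 / q)"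
      using q by (simp add: power2_eq_square)
    then have "a = 0" using q by (simp add: divide_le_0_iff)
    then show ?thesis by (simp add: a_def)
  qed (simp add: zero)
  then show ?thesis by blast
qed

lemma cinner_eqI:
  fixes v w :: "'a::complex_hilbert"
  assumes "\<And>x. cinner x v = cinner x w"
  shows "v = w"
proof -
  have "\<forall>x. inner x v = inner x w" unfolding inner_eq_Re_cinner using assms by simp
  then show ?thesis by (simp only: vector_eq_ldot)
qed

lemma cadjoint_works:
  fixes T :: "'a::complex_hilbert \<Rightarrow> 'a"
  assumes T: "bounded_clinear T"
  shows "cinner (T x) y = cinner x (cadjoint T y)"
proof -
  have lin: "bounded_linear T" and T_scaleC: "\<And>a x. T (a *\<^sub>C x) = a *\<^sub>C T x"
    using T by (auto simp: bounded_clinear_def)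
  have "\<exists>v. \<forall>x. cinner (T x) y = cinner x v" for y
  proof -
    have "bounded_linear (\<lambda>x. inner (T x) y)"
      by (rule bounded_linear_compose[OF bounded_linear_inner_left lin])
    then obtain v where v: "\<And>x. inner (T x) y = inner v x"
      using riesz_representation_real by blast
    have Re: "Re (cinner (T x) y) = Re (cinner x v)" for x
      using trans[OF v[of x] inner_commute] unfolding inner_eq_Re_cinner .
    have "cinner (T x) y = cinner x v" for x
    proof (rule complex_eqI[OF Re])
      show "Im (cinner (T x) y) = Im (cinner x v)"
        using Re[of "\<i> *\<^sub>C x"] by (simp add: T_scaleC cinner_scaleC_left)
    qed
    then show ?thesis by blast
  qed
  then obtain S where "\<forall>x y. cinner (T x) y = cinner x (S y)" by metis
  then have "\<forall>x y. cinner (T x) y = cinner x (cadjoint T y)"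
    unfolding cadjoint_def by (rule someI[where P = "\<lambda>S. \<forall>x y. cinner (T x) y = cinner x (S y)"])
  then show ?thesis by simp
qed

lemma cadjoint_unique:
  fixes T :: "'a::complex_hilbert \<Rightarrow> 'a"
  assumes T: "bounded_clinear T" and "\<And>x y. cinner (T x) y = cinner x (S y)"
  shows "S = cadjoint T"
proof (rule ext, rule cinner_eqI)
  fix x y
  show "cinner x (S y) = cinner x (cadjoint T y)"
    using assms(2)[of x y] cadjoint_works[OF T, of x y] by (rule trans[OF sym])
qed

end

theory Submission
  imports Defs "HOL-Complex_Analysis.Conformal_Mappings" "Jordan_Normal_Form.Determinant"
begin

text \<open>
The proof studies the numerical range \<open>W(A)\<close> where it touches the unit circle. For unimodular \<open>z\<close> the operator
\<open>I - Re (cnj z A)\<close> (the gap operator) is positive because \<open>W(A)\<close> lies in the closed disk, and \<open>z\<close> belongs to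
\<open>W(A)\<close> if and only if it has a nonzero kernel
(\<open>unimodular_in_numerical_range_iff\<close>). What remains is to see that
infinitely many such \<open>z\<close> force all of them.

The hypotheses on \<open>A = N + K\<close> and on the essential spectrum make the gap operator a finite-rank perturbation of a
coercive operator. For a normal operator the extreme essential value \<open>h\<close> of \<open>Re (cnj z N)\<close> belongs to an
essential approximate eigenvalue \<open>z (h + \<i> g)\<close> of \<open>N\<close>: the real and imaginary parts commute, and maximising the two
quadratic forms one after the other produces joint approximate eigenvectors orthogonal to any given finite set
(\<open>approximate_eigenvalue_in_every_finite_codim\<close>). On such vectors \<open>K\<close> is negligible and Fredholm operators are
bounded below, so \<open>z (h + \<i> g)\<close> lies in the essential spectrum of \<open>A\<close> and \<open>h < 1\<close>
(\<open>real_part_gap_on_finite_codim\<close>).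

Coercivity up to finite rank has two consequences. Limits on the circle of values of the form are attained
(\<open>unimodular_closure_numerical_range_attained\<close>), so the intersection \<open>Z\<close> of the circle with \<open>W(A)\<close> itself is
infinite. Moreover, on the circle the gap operator coincides up to a scalar with a quadratic operator polynomial, and
a finite determinant describes its kernel; so \<open>Z\<close> is locally the zero set of a holomorphic function
(\<open>unimodular_numerical_range_locally_zero_set\<close>). Since \<open>Z\<close> is infinite and the circle is compact and connected, the
identity theorem propagates from an accumulation point of \<open>Z\<close> to the whole circle
(\<open>locally_zero_set_infinite_imp_everything\<close>). Finally \<open>W(A)\<close> is convex (\<open>convex_numerical_range\<close>) and contains the
circle, so it is the closed disk.
\<close>

section \<open>Vectors orthogonal to finite sets\<close>

text \<open>This replaces weakly null sequences of unit vectors: instead of asking that \<open>x\<close> be almost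
orthogonal to every fixed vector in the limit, \<open>x\<close> is exactly orthogonal to a prescribed finite set.
A symmetric operator \<open>S\<close> preserves such a condition up to enlarging the finite set, because
\<open>S x\<close> is orthogonal to \<open>b\<close> as soon as \<open>x\<close> is orthogonal to \<open>S b\<close>. The tolerance \<open>\<epsilon>\<close> is
passed to \<open>P\<close>, so that \<open>P\<close> describes an approximate property.\<close>

definition in_every_finite_codim :: "(real \<Rightarrow> 'a::real_inner \<Rightarrow> bool) \<Rightarrow> bool" where
  "in_every_finite_codim P \<longleftrightarrow> (\<forall>B \<epsilon>. finite B \<longrightarrow> 0 < \<epsilon> \<longrightarrow>
     (\<exists>x. norm x = 1 \<and> (\<forall>b\<in>B. inner x b = 0) \<and> P \<epsilon> x))"

lemma in_every_finite_codimE: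
  assumes "in_every_finite_codim P" "finite B" "0 < \<epsilon>"
  obtains x where "norm x = 1" "\<And>b. b \<in> B \<Longrightarrow> inner x b = 0" "P \<epsilon> x"
  using assms unfolding in_every_finite_codim_def by blast

lemma bounded_linear_bound_ge_one:
  fixes f :: "'a::real_normed_vector \<Rightarrow> 'b::real_normed_vector"
  assumes "bounded_linear f"
  obtains C where "1 \<le> C" "\<And>x. norm (f x) \<le> C * norm x"
proof -
  obtain K where K: "\<And>x. norm (f x) \<le> norm x * K"
    using bounded_linear.bounded[OF assms] by blast
  have "norm (f x) \<le> max 1 K * norm x" for x
    using K[of x] mult_right_mono[of K "max 1 K" "norm x"] by (simp add: mult.commute)
  then show ?thesis using that[of "max 1 K"] by simp
qed

text \<open>The number \<open>g\<close> is the largest essential value of the quadratic form of \<open>S\<close> among approximate null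
vectors of \<open>T\<close>. A vector \<open>x\<close> that almost attains it is almost an eigenvector: otherwise \<open>S - g\<close> moves
\<open>x\<close> noticeably, and \<open>x + s (S - g) x\<close> with a small \<open>s > 0\<close> would have a quadratic form noticeably
above \<open>g\<close>. That competitor is admissible because \<open>S\<close> commutes with \<open>T\<close> and is symmetric. With
\<open>T = 0\<close> this finds an essential approximate eigenvalue of one operator; applied again with
\<open>T = H - h\<close> it finds a joint approximate eigenvector of two commuting operators, which takes the place
of the spectral theorem for normal operators.\<close>

lemma approximate_eigenvalue_in_every_finite_codim:
  fixes S T :: "'a::real_inner \<Rightarrow> 'a"
  assumes S: "bounded_linear S" and T: "bounded_linear T"
    and sym: "\<And>x y. inner (S x) y = inner x (S y)"
    and comm: "\<And>x. S (T x) = T (S x)"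
    and appr: "in_every_finite_codim (\<lambda>\<epsilon> x. norm (T x) \<le> \<epsilon> \<and> c - \<epsilon> \<le> inner (S x) x)"
  obtains g where "c \<le> g"
    "in_every_finite_codim (\<lambda>\<epsilon> x. norm (T x) \<le> \<epsilon> \<and> norm (S x - g *\<^sub>R x) \<le> \<epsilon>)"
proof -
  define Q where "Q a \<longleftrightarrow> in_every_finite_codim (\<lambda>\<epsilon> x. norm (T x) \<le> \<epsilon> \<and> a - \<epsilon> \<le> inner (S x) x)" for a
  interpret S: bounded_linear S by (rule S)
  interpret T: bounded_linear T by (rule T)
  obtain CS where CS: "1 \<le> CS" "\<And>x. norm (S x) \<le> CS * norm x"
    using bounded_linear_bound_ge_one[OF S] by blast
  have Q_le: "a \<le> CS + 1" if Qa: "Q a" for a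
  proof -
    obtain x where x: "norm x = 1" "a - 1 \<le> inner (S x) x"
      using in_every_finite_codimE[OF Qa[unfolded Q_def], of "{}" 1] by auto
    have "inner (S x) x \<le> CS"
      using norm_cauchy_schwarz[of "S x" x] CS(2)[of x] x(1) by simp
    then show ?thesis using x(2) by simp
  qed
  have Qc: "Q c" using appr by (simp add: Q_def)
  have bdd: "bdd_above (Collect Q)" by (rule bdd_aboveI[of _ "CS + 1"]) (simp add: Q_le)
  define g where "g = Sup (Collect Q)"
  have cg: "c \<le> g" unfolding g_def using Qc bdd by (auto intro: cSup_upper)
  have lower: "\<exists>x. norm x = 1 \<and> (\<forall>b\<in>B. inner x b = 0) \<and> norm (T x) \<le> \<epsilon> \<and> g - \<epsilon> \<le> inner (S x) x"
    if B: "finite B" and \<epsilon>: "0 < \<epsilon>" for B \<epsilon>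
  proof -
    obtain a where a: "Q a" "g - \<epsilon>/2 < a"
      using less_cSupD[of "Collect Q" "g - \<epsilon>/2"] Qc \<epsilon> unfolding g_def[symmetric] by auto
    obtain x where "norm x = 1" "\<And>b. b \<in> B \<Longrightarrow> inner x b = 0" "norm (T x) \<le> \<epsilon>/2" "a - \<epsilon>/2 \<le> inner (S x) x"
      using in_every_finite_codimE[OF a(1)[unfolded Q_def] B, of "\<epsilon>/2"] \<epsilon> by auto
    then show ?thesis using a(2) \<epsilon> by (intro exI[of _ x]) auto
  qed
  have upper: "\<exists>B \<epsilon>. finite B \<and> 0 < \<epsilon> \<and> (\<forall>x. norm x = 1 \<longrightarrow> (\<forall>b\<in>B. inner x b = 0) \<longrightarrow>
      norm (T x) \<le> \<epsilon> \<longrightarrow> inner (S x) x \<le> g + \<eta>)" if "0 < \<eta>" for \<eta>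
  proof -
    have "\<not> Q (g + \<eta>)" using cSup_upper[OF _ bdd, of "g + \<eta>"] that unfolding g_def[symmetric] by auto
    then obtain B \<epsilon> where B: "finite B" "0 < \<epsilon>" and no: "\<not> (\<exists>x. norm x = 1 \<and> (\<forall>b\<in>B. inner x b = 0) \<and>
        norm (T x) \<le> \<epsilon> \<and> g + \<eta> - \<epsilon> \<le> inner (S x) x)"
      unfolding Q_def in_every_finite_codim_def by blast
    have "inner (S x) x \<le> g + \<eta>" if x: "norm x = 1" "\<forall>b\<in>B. inner x b = 0" "norm (T x) \<le> \<epsilon>" for x
    proof -
      have "\<not> (g + \<eta> - \<epsilon> \<le> inner (S x) x)" using no x by blast
      then show ?thesis using B by simp
    qed
    then show ?thesis using B by blast
  qed
  define D where "D x = S x - g *\<^sub>R x" for x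
  have D: "bounded_linear D" unfolding D_def
    by (intro bounded_linear_sub S bounded_linear_scaleR_right)
  interpret D: bounded_linear D by (rule D)
  obtain C where C: "1 \<le> C" "\<And>x. norm (D x) \<le> C * norm x"
    using bounded_linear_bound_ge_one[OF D] by blast
  have "in_every_finite_codim (\<lambda>\<epsilon> x. norm (T x) \<le> \<epsilon> \<and> norm (D x) \<le> \<epsilon>)"
    unfolding in_every_finite_codim_def
  proof (intro allI impI)
    fix B :: "'a set" and \<epsilon> :: real assume B: "finite B" and \<epsilon>: "0 < \<epsilon>"
    \<comment> \<open>The first bound keeps the norm of the competitor between \<open>1/2\<close> and \<open>2\<close>; the second makes the term
      of second order in \<open>s\<close> at most \<open>s \<epsilon>\<^sup>2\<close>.\<close>
    define s where "s = min (1 / (2*C)) (\<epsilon>\<^sup>2 / C^3)"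
    have s: "0 < s" "s * C \<le> 1/2" "s * C^3 \<le> \<epsilon>\<^sup>2"
    proof -
      show "0 < s" using C(1) \<epsilon> by (simp add: s_def)
      have "s * C \<le> 1/(2*C) * C" using C(1) by (intro mult_right_mono) (auto simp: s_def)
      then show "s * C \<le> 1/2" using C(1) by simp
      have "s * C^3 \<le> \<epsilon>\<^sup>2 / C^3 * C^3" using C(1) by (intro mult_right_mono) (auto simp: s_def)
      then show "s * C^3 \<le> \<epsilon>\<^sup>2" using C(1) by simp
    qed
    define \<eta> where "\<eta> = s * \<epsilon>\<^sup>2 / 5"
    have \<eta>: "0 < \<eta>" using s(1) \<epsilon> by (simp add: \<eta>_def)
    obtain B0 \<epsilon>0 where B0: "finite B0" "0 < \<epsilon>0" and up: "\<And>x. norm x = 1 \<Longrightarrow> \<forall>b\<in>B0. inner x b = 0 \<Longrightarrow>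
      norm (T x) \<le> \<epsilon>0 \<Longrightarrow> inner (S x) x \<le> g + \<eta>" using upper[OF \<eta>] by blast
    define \<epsilon>1 where "\<epsilon>1 = min \<eta> (min \<epsilon> (\<epsilon>0/4))"
    have \<epsilon>1: "0 < \<epsilon>1" "\<epsilon>1 \<le> \<eta>" "\<epsilon>1 \<le> \<epsilon>" "4 * \<epsilon>1 \<le> \<epsilon>0" using \<eta> \<epsilon> B0 by (auto simp: \<epsilon>1_def)
    \<comment> \<open>Orthogonality to \<open>S ` B0\<close> makes \<open>S x\<close>, and with it the competitor, orthogonal to \<open>B0\<close>.\<close>
    have "finite (B \<union> B0 \<union> S ` B0)" using B B0 by simp
    from lower[OF this \<epsilon>1(1)] obtain x where x: "norm x = 1"
      "\<And>b. b \<in> B \<union> B0 \<union> S ` B0 \<Longrightarrow> inner x b = 0" "norm (T x) \<le> \<epsilon>1" "g - \<epsilon>1 \<le> inner (S x) x" by blast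
    define u where "u = D x"
    define y where "y = x + s *\<^sub>R u"
    have nu: "norm u \<le> C" using C(2)[of x] x(1) by (simp add: u_def)
    have nsu: "norm (s *\<^sub>R u) \<le> 1/2"
      using order_trans[OF mult_left_mono[OF nu] s(2)] s(1) by simp
    have ylow: "1/2 \<le> norm y" using norm_diff_ineq[of x "s *\<^sub>R u"] nsu x(1) unfolding y_def by linarith
    have yup: "norm y \<le> 2" using norm_triangle_ineq[of x "s *\<^sub>R u"] nsu x(1) unfolding y_def by linarith
    have yB: "inner y b = 0" if "b \<in> B0" for b
    proof -
      have "inner x b = 0" "inner x (S b) = 0" using x(2) that by auto
      then show ?thesis unfolding y_def u_def D_def by (simp add: inner_simps sym)
    qed
    have Ty: "norm (T y) \<le> 2 * \<epsilon>1"
    proof -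
      have "T y = T x + s *\<^sub>R D (T x)"
        unfolding y_def u_def D_def by (simp add: T.add T.scaleR T.diff comm)
      then have "norm (T y) \<le> norm (T x) + s * norm (D (T x))"
        using norm_triangle_ineq[of "T x" "s *\<^sub>R D (T x)"] s(1) by simp
      also have "\<dots> \<le> norm (T x) + s * (C * norm (T x))"
        using C(2)[of "T x"] s(1) by simp
      also have "\<dots> = (1 + s * C) * norm (T x)" by (simp add: algebra_simps)
      also have "\<dots> \<le> 2 * \<epsilon>1" using s x(3) C(1) by (intro mult_mono) auto
      finally show ?thesis .
    qed
    have "inner (S y) y \<le> (g + \<eta>) * (norm y)\<^sup>2"
    proof -
      define w where "w = inverse (norm y) *\<^sub>R y"
      have n0: "norm y > 0" using ylow by linarith
      have w1: "norm w = 1" using n0 by (simp add: w_def)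
      have w2: "\<forall>b\<in>B0. inner w b = 0" using yB by (simp add: w_def)
      have "norm (T w) = inverse (norm y) * norm (T y)" using n0 by (simp add: w_def T.scaleR)
      also have "\<dots> \<le> 2 * (2 * \<epsilon>1)"
      proof (intro mult_mono Ty)
        show "inverse (norm y) \<le> 2" using le_imp_inverse_le[OF ylow] by simp
      qed auto
      finally have "norm (T w) \<le> \<epsilon>0" using \<epsilon>1 by simp
      from up[OF w1 w2 this] have "inner (S w) w \<le> g + \<eta>" .
      moreover have "inner (S w) w = inner (S y) y / (norm y)\<^sup>2"
        by (simp add: w_def S.scaleR power2_eq_square divide_simps)
      ultimately show ?thesis using n0 by (simp add: divide_simps)
    qed
    then have "inner (D y) y \<le> \<eta> * (norm y)\<^sup>2"
      by (simp add: D_def inner_simps power2_norm_eq_inner algebra_simps)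
    also have "\<dots> \<le> \<eta> * 4"
      using \<eta> yup power_mono[OF yup, of 2] by (intro mult_left_mono) auto
    finally have Dy: "inner (D y) y \<le> 4 * \<eta>" by simp
    have symD: "inner (D a) b = inner a (D b)" for a b
      by (simp add: D_def inner_simps sym)
    have "inner (D x) u = (norm u)\<^sup>2" "inner (D u) x = (norm u)\<^sup>2"
      using symD[of u x] by (simp_all add: u_def power2_norm_eq_inner)
    then have "inner (D y) y = inner (D x) x + 2 * s * (norm u)\<^sup>2 + s\<^sup>2 * inner (D u) u"
      unfolding y_def
      by (simp only: D.add D.scaleR inner_simps) (simp add: power2_eq_square algebra_simps)
    moreover have "inner (D x) x \<ge> - \<eta>"
      using x(4) \<epsilon>1 x(1) by (simp add: D_def inner_simps norm_eq_1)
    moreover have "s\<^sup>2 * inner (D u) u \<ge> - (s * \<epsilon>\<^sup>2)"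
    proof -
      have "\<bar>inner (D u) u\<bar> \<le> norm (D u) * norm u" by (rule Cauchy_Schwarz_ineq2)
      also have "\<dots> \<le> (C * norm u) * norm u" by (intro mult_right_mono C) auto
      also have "\<dots> \<le> (C * C) * C" using nu C by (intro mult_mono) auto
      finally have "\<bar>inner (D u) u\<bar> \<le> C^3" by (simp add: power3_eq_cube)
      then have "s\<^sup>2 * \<bar>inner (D u) u\<bar> \<le> s\<^sup>2 * C^3" by (intro mult_left_mono) auto
      also have "\<dots> = s * (s * C^3)" by (simp add: power2_eq_square)
      also have "\<dots> \<le> s * \<epsilon>\<^sup>2" using s by (intro mult_left_mono) auto
      finally have "\<bar>s\<^sup>2 * inner (D u) u\<bar> \<le> s * \<epsilon>\<^sup>2" by (simp add: abs_mult)
      then show ?thesis by linarith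
    qed
    ultimately have "2 * s * (norm u)\<^sup>2 \<le> 5 * \<eta> + s * \<epsilon>\<^sup>2" using Dy by linarith
    then have "s * (norm u)\<^sup>2 \<le> s * \<epsilon>\<^sup>2" unfolding \<eta>_def by simp
    then have "(norm u)\<^sup>2 \<le> \<epsilon>\<^sup>2" using s(1) by simp
    then have "norm (D x) \<le> \<epsilon>" using \<epsilon> by (simp add: u_def power2_le_iff_abs_le)
    then show "\<exists>x. norm x = 1 \<and> (\<forall>b\<in>B. inner x b = 0) \<and> norm (T x) \<le> \<epsilon> \<and> norm (D x) \<le> \<epsilon>"
      using x \<epsilon>1 by (intro exI[of _ x]) auto
  qed
  then show ?thesis using that[OF cg] by (simp add: D_def)
qed

text \<open>If \<open>V y\<close> represents the functional \<open>x \<mapsto> \<langle>K x, y\<rangle>\<close> and \<open>Y\<close> is a finite \<open>\<epsilon>\<close>-net of the image of the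
unit ball, then for \<open>x\<close> in the unit ball orthogonality to all \<open>V y\<close> makes \<open>K x\<close> orthogonal to \<open>Y\<close> although \<open>K x\<close> is close to
an element of \<open>Y\<close>; so \<open>K x\<close> is small.\<close>

lemma compact_small_on_finite_codim:
  fixes K :: "'a::{real_inner,complete_space} \<Rightarrow> 'a"
  assumes K: "bounded_linear K" and comp: "compact (closure (K ` cball 0 1))" and \<epsilon>: "0 < \<epsilon>"
  obtains B where "finite B" "\<And>x. \<forall>b\<in>B. inner x b = 0 \<Longrightarrow> norm (K x) \<le> \<epsilon> * norm x"
proof -
  interpret K: bounded_linear K by (rule K)
  obtain Y where Y: "finite Y" "closure (K ` cball 0 1) \<subseteq> (\<Union>y\<in>Y. ball y \<epsilon>)"
    using comp[unfolded compact_eq_totally_bounded] \<epsilon> by blast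
  have "\<exists>v. \<forall>x. inner (K x) y = inner v x" for y
    by (rule riesz_representation_real) (rule bounded_linear_compose[OF bounded_linear_inner_left K])
  then obtain V where V: "\<And>x y. inner (K x) y = inner (V y) x" by metis
  have "norm (K x) \<le> \<epsilon> * norm x" if x: "\<forall>b\<in>V ` Y. inner x b = 0" for x
  proof (cases "x = 0")
    case False
    define w where "w = inverse (norm x) *\<^sub>R x"
    have "w \<in> cball 0 1" using False by (simp add: w_def)
    then obtain y where y: "y \<in> Y" "K w \<in> ball y \<epsilon>"
      using Y(2) subsetD[OF closure_subset imageI, of w "cball 0 1" K] by blast
    have "inner (K w) y = inner (V y) w" by (rule V)
    also have "\<dots> = 0" using x y(1) by (simp add: w_def inner_commute[of _ x])
    finally have "inner (K w) y = 0" .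
    then have "(norm (K w))\<^sup>2 = inner (K w) (K w - y)" by (simp add: inner_simps power2_norm_eq_inner)
    also have "\<dots> \<le> norm (K w) * norm (K w - y)" by (rule norm_cauchy_schwarz)
    also have "\<dots> \<le> norm (K w) * \<epsilon>"
      using y(2) by (intro mult_left_mono) (auto simp: dist_norm norm_minus_commute)
    finally have "norm (K w) \<le> \<epsilon>" using \<epsilon> by (cases "norm (K w) = 0") (auto simp: power2_eq_square)
    then show ?thesis using False by (simp add: w_def K.scaleR divide_simps mult.commute)
  qed (simp add: K.zero)
  then show ?thesis using that[of "V ` Y"] Y(1) by blast
qed
instance complex_hilbert \<subseteq> banach ..

text \<open>The open mapping theorem onto a closed range. By Baire's theorem the closure of the image of some ball
has interior points relative to the range; subtracting two approximate preimages moves that ball to the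
origin, and a geometric series of corrections turns approximate solutions into exact ones.\<close>

lemma closed_range_bounded_preimage:
  fixes T :: "'a::banach \<Rightarrow> 'b::banach"
  assumes T: "bounded_linear T" and cl: "closed (range T)"
  obtains C where "0 < C" "\<And>x. \<exists>x'. T x' = T x \<and> norm x' \<le> C * norm (T x)"
proof -
  interpret T: bounded_linear T by (rule T)
  define X where "X = top_of_set (range T)"
  define F where "F n = range T \<inter> closure (T ` cball 0 (real n))" for n
  have "\<exists>n. X interior_of F n \<noteq> {}"
  proof (rule ccontr)
    assume "\<not> ?thesis"
    then have emp: "X interior_of F n = {}" for n by blast
    have "completely_metrizable_space X"
      unfolding X_def by (intro completely_metrizable_space_closedin completely_metrizable_space_euclidean)
        (simp add: cl)
    moreover have "closedin X (F n)" for n by (simp add: X_def F_def closedin_closed_Int)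
    ultimately have "X interior_of \<Union>(range F) = {}"
      by (intro Baire_category_alt) (auto simp: emp)
    moreover have "\<Union>(range F) = range T"
    proof (intro equalityI subsetI)
      fix y assume "y \<in> range T"
      then obtain x where x: "y = T x" by blast
      obtain n where "norm x \<le> real n" using real_arch_simple by blast
      then have "y \<in> T ` cball 0 (real n)" using x by auto
      then have "y \<in> closure (T ` cball 0 (real n))" by (rule subsetD[OF closure_subset])
      then have "y \<in> F n" by (simp add: F_def x)
      then show "y \<in> \<Union>(range F)" by blast
    qed (auto simp: F_def)
    ultimately have "X interior_of (topspace X) = {}" by (simp add: X_def)
    then show False unfolding interior_of_topspace by (simp add: X_def)
  qed
  then obtain n y0 where "y0 \<in> X interior_of F n" by blast
  then obtain V where V: "openin X V" "y0 \<in> V" "V \<subseteq> F n" unfolding interior_of_def by blast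
  obtain U where U: "open U" "V = range T \<inter> U" using V(1) unfolding X_def openin_open by blast
  obtain r where r: "0 < r" "ball y0 r \<subseteq> U" using U V(2) open_contains_ball by blast
  have y0: "y0 \<in> range T" using V U by blast
  have near: "\<exists>x. norm x \<le> 2 * real n \<and> norm (T x - y) < \<epsilon>" if y: "y \<in> range T" "norm y < r" "0 < \<epsilon>" for y \<epsilon>
  proof -
    obtain p q where pq: "y0 = T p" "y = T q" using y0 y(1) by blast
    then have "y0 + y = T (p + q)" by (simp add: T.add)
    then have "y0 + y \<in> range T" by blast
    moreover have "y0 + y \<in> ball y0 r" using y(2) by (simp add: dist_norm)
    ultimately have "y0 + y \<in> closure (T ` cball 0 (real n))" "y0 \<in> closure (T ` cball 0 (real n))"
      using r U V unfolding F_def by blast+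
    then have "\<exists>z\<in>T ` cball 0 (real n). dist z (y0 + y) < \<epsilon>/2" "\<exists>z\<in>T ` cball 0 (real n). dist z y0 < \<epsilon>/2"
      unfolding closure_approachable using half_gt_zero[OF y(3)] by blast+
    then obtain a b where ab: "a \<in> cball 0 (real n)" "dist (T a) (y0 + y) < \<epsilon>/2"
        "b \<in> cball 0 (real n)" "dist (T b) y0 < \<epsilon>/2" by blast
    have "T (a - b) - y = (T a - (y0 + y)) - (T b - y0)" by (simp add: T.diff)
    then have "norm (T (a - b) - y) \<le> norm (T a - (y0 + y)) + norm (T b - y0)"
      by (metis norm_triangle_ineq4)
    then have "norm (T (a - b) - y) < \<epsilon>" using ab by (simp add: dist_norm)
    moreover have "norm (a - b) \<le> 2 * real n" using norm_triangle_ineq4[of a b] ab by simp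
    ultimately show ?thesis by blast
  qed
  \<comment> \<open>Vectors of norm \<open>r / 2\<close> have approximate preimages of norm at most \<open>2 n\<close>; \<open>M\<close> is the quotient.\<close>
  define M where "M = 4 * real n / r"
  have M: "0 \<le> M" using r by (simp add: M_def)
  have half: "\<exists>x. norm x \<le> M * norm y \<and> norm (y - T x) \<le> norm y / 2" if y: "y \<in> range T" for y
  proof (cases "y = 0")
    case True then show ?thesis by (intro exI[of _ 0]) (simp add: T.zero)
  next
    case False
    define t where "t = r / (2 * norm y)"
    have t: "0 < t" using False r by (simp add: t_def)
    obtain q where "y = T q" using y by blast
    then have "t *\<^sub>R y = T (t *\<^sub>R q)" by (simp add: T.scaleR)
    then have "t *\<^sub>R y \<in> range T" by blast
    moreover have "norm (t *\<^sub>R y) < r" using False r by (simp add: t_def)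
    ultimately obtain x where x: "norm x \<le> 2 * real n" "norm (T x - t *\<^sub>R y) < r/4"
      using near[of "t *\<^sub>R y" "r/4"] r by auto
    define x' where "x' = inverse t *\<^sub>R x"
    have "y - T x' = - (inverse t *\<^sub>R (T x - t *\<^sub>R y))" using t by (simp add: x'_def T.scaleR algebra_simps)
    then have "norm (y - T x') = inverse t * norm (T x - t *\<^sub>R y)" using t by simp
    also have "\<dots> \<le> inverse t * (r/4)" using x t by (intro mult_left_mono) auto
    also have "\<dots> = norm y / 2" using r by (simp add: t_def)
    finally have 1: "norm (y - T x') \<le> norm y / 2" .
    have "norm x' = inverse t * norm x" using t by (simp add: x'_def)
    also have "\<dots> \<le> inverse t * (2 * real n)" using x t by (intro mult_left_mono) auto
    also have "\<dots> = M * norm y" using r by (simp add: t_def M_def)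
    finally show ?thesis using 1 by blast
  qed
  then obtain h where h: "\<And>y. y \<in> range T \<Longrightarrow> norm (h y) \<le> M * norm y \<and> norm (y - T (h y)) \<le> norm y / 2"
    by metis
  have "\<exists>x'. T x' = y \<and> norm x' \<le> (2 * M + 1) * norm y" if y: "y \<in> range T" for y
  proof -
    define Y where "Y = rec_nat y (\<lambda>_ z. z - T (h z))"
    have Y0: "Y 0 = y" and YS: "Y (Suc k) = Y k - T (h (Y k))" for k by (simp_all add: Y_def)
    have YR: "Y k \<in> range T" for k
    proof (induction k)
      case (Suc k)
      then obtain a where "Y k = T a" by blast
      then have "Y (Suc k) = T (a - h (Y k))" by (simp add: YS T.diff)
      then show ?case by blast
    qed (simp add: Y0 y)
    have Yn: "norm (Y k) \<le> norm y * (1/2)^k" for k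
    proof (induction k)
      case (Suc k) then show ?case using h[OF YR[of k]] by (simp add: YS)
    qed (simp add: Y0)
    have hn: "norm (h (Y k)) \<le> M * norm y * (1/2)^k" for k
      using h[OF YR[of k]] mult_left_mono[OF Yn[of k] M] by (simp add: mult.assoc)
    have sg: "summable (\<lambda>k. M * norm y * (1/2::real)^k)" by (intro summable_mult) simp
    have sn: "summable (\<lambda>k. norm (h (Y k)))"
      by (rule summable_comparison_test'[OF sg, of 0]) (use hn in auto)
    define x' where "x' = (\<Sum>k. h (Y k))"
    have lim: "(\<lambda>n. \<Sum>k<n. h (Y k)) \<longlonglongrightarrow> x'"
      using summable_LIMSEQ[OF summable_norm_cancel[OF sn]] by (simp add: x'_def)
    have part: "T (\<Sum>k<n. h (Y k)) = y - Y n" for n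
      by (induction n) (simp_all add: T.zero T.add Y0 YS)
    have "(\<lambda>k. (1/2::real)^k) \<longlonglongrightarrow> 0" by (rule LIMSEQ_power_zero) simp
    then have "(\<lambda>k. norm y * (1/2::real)^k) \<longlonglongrightarrow> 0" by (rule tendsto_mult_right_zero)
    then have "Y \<longlonglongrightarrow> 0" by (rule Lim_null_comparison[rotated]) (simp only: Yn eventually_True)
    then have l1: "(\<lambda>n. T (\<Sum>k<n. h (Y k))) \<longlonglongrightarrow> y - 0" unfolding part by (rule tendsto_diff[OF tendsto_const])
    have Tx: "T x' = y" using LIMSEQ_unique[OF T.tendsto[OF lim] l1] by simp
    have "norm x' \<le> (\<Sum>k. norm (h (Y k)))" unfolding x'_def by (rule summable_norm[OF sn])
    also have "\<dots> \<le> (\<Sum>k. M * norm y * (1/2::real)^k)" by (rule suminf_le[OF hn sn sg])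
    also have "\<dots> = M * norm y * 2" by (subst suminf_mult) (simp_all add: suminf_geometric)
    also have "\<dots> \<le> (2 * M + 1) * norm y" by (simp add: algebra_simps)
    finally have "norm x' \<le> (2 * M + 1) * norm y" .
    then show ?thesis using Tx by blast
  qed
  then show ?thesis using that[of "2 * M + 1"] M by auto
qed

section \<open>The complex inner product and bounded complex-linear operators\<close>

lemma cinner_add_right: "cinner x (y + z) = cinner x y + cinner x z" for x :: "'a::complex_hilbert"
  by (metis cinner_add_left cinner_commute complex_cnj_add)

lemma cinner_scaleC_right: "cinner x (a *\<^sub>C y) = cnj a * cinner x y" for x :: "'a::complex_hilbert"
  by (metis cinner_commute cinner_scaleC_left complex_cnj_mult)

lemma scaleC_zero_left [simp]: "0 *\<^sub>C x = 0" for x :: "'a::complex_hilbert"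
  by (rule complex_vector.scale_zero_left)

lemma scaleC_zero_right [simp]: "a *\<^sub>C 0 = (0::'a::complex_hilbert)"
  by (rule complex_vector.scale_zero_right)

lemma cinner_zero_left [simp]: "cinner 0 x = 0" for x :: "'a::complex_hilbert"
  using cinner_scaleC_left[of 0 0 x] by simp

lemma cinner_zero_right [simp]: "cinner x 0 = 0" for x :: "'a::complex_hilbert"
  using cinner_scaleC_right[of x 0 0] by simp

lemma cinner_minus_left: "cinner (- x) y = - cinner x y" for x :: "'a::complex_hilbert"
  using cinner_scaleC_left[of "-1" x y] by (simp add: scaleC_one)

lemma cinner_minus_right: "cinner x (- y) = - cinner x y" for x :: "'a::complex_hilbert"
  using cinner_scaleC_right[of x "-1" y] by (simp add: scaleC_one)

lemma cinner_diff_left: "cinner (x - y) z = cinner x z - cinner y z" for x :: "'a::complex_hilbert"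
  using cinner_add_left[of x "- y" z] by (simp add: cinner_minus_left)

lemma cinner_diff_right: "cinner x (y - z) = cinner x y - cinner x z" for x :: "'a::complex_hilbert"
  using cinner_add_right[of x y "- z"] by (simp add: cinner_minus_right)

lemma cinner_scaleR_left: "cinner (r *\<^sub>R x) y = complex_of_real r * cinner x y" for x :: "'a::complex_hilbert"
  by (simp add: scaleR_eq_scaleC cinner_scaleC_left)

lemma cinner_scaleR_right: "cinner x (r *\<^sub>R y) = complex_of_real r * cinner x y" for x :: "'a::complex_hilbert"
  by (simp add: scaleR_eq_scaleC cinner_scaleC_right)

lemma cinner_sum_left: "cinner (\<Sum>i\<in>I. f i) y = (\<Sum>i\<in>I. cinner (f i) y)" for y :: "'a::complex_hilbert"
  by (induction I rule: infinite_finite_induct) (simp_all add: cinner_add_left)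

lemma cinner_sum_right: "cinner y (\<Sum>i\<in>I. f i) = (\<Sum>i\<in>I. cinner y (f i))" for y :: "'a::complex_hilbert"
  by (induction I rule: infinite_finite_induct) (simp_all add: cinner_add_right)

lemmas cinner_simps = cinner_add_left cinner_add_right cinner_diff_left cinner_diff_right
  cinner_minus_left cinner_minus_right cinner_scaleC_left cinner_scaleC_right
  cinner_scaleR_left cinner_scaleR_right

lemma norm_scaleC [simp]: "norm (a *\<^sub>C x) = cmod a * norm x" for x :: "'a::complex_hilbert"
proof -
  have "cinner (a *\<^sub>C x) (a *\<^sub>C x) = (a * cnj a) * cinner x x"
    by (simp add: cinner_scaleC_left cinner_scaleC_right mult_ac)
  then have "complex_of_real ((norm (a *\<^sub>C x))\<^sup>2) = complex_of_real ((cmod a)\<^sup>2 * (norm x)\<^sup>2)"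
    unfolding cinner_self complex_norm_square[symmetric] by simp
  then have "(norm (a *\<^sub>C x))\<^sup>2 = (cmod a * norm x)\<^sup>2"
    by (simp only: of_real_eq_iff power_mult_distrib)
  then show ?thesis by simp
qed

text \<open>Rotating \<open>x\<close> by a unimodular scalar makes \<open>cinner x y\<close> real, which reduces the claim to the real
inner product.\<close>

lemma cinner_Cauchy_Schwarz: "cmod (cinner x y) \<le> norm x * norm y" for x :: "'a::complex_hilbert"
proof (cases "cinner x y = 0")
  case False
  define a where "a = cnj (sgn (cinner x y))"
  have a: "cmod a = 1" using False by (simp add: a_def norm_sgn)
  have "a * cinner x y = cnj (cinner x y) * cinner x y / cmod (cinner x y)"
    by (simp add: a_def sgn_eq)
  also have "\<dots> = cmod (cinner x y)"
    using False by (simp add: complex_norm_square[symmetric] power2_eq_square mult.commute)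
  finally have "complex_of_real (cmod (cinner x y)) = cinner (a *\<^sub>C x) y"
    by (simp add: cinner_scaleC_left)
  then have "cmod (cinner x y) = inner (a *\<^sub>C x) y"
    unfolding inner_eq_Re_cinner by (metis Re_complex_of_real)
  also have "\<dots> \<le> norm (a *\<^sub>C x) * norm y" by (rule norm_cauchy_schwarz)
  finally show ?thesis by (simp add: a)
qed simp

lemma bounded_clinearI:
  assumes "\<And>x y. T (x + y) = T x + T y" "\<And>a x. T (a *\<^sub>C x) = a *\<^sub>C T x" "\<And>x. norm (T x) \<le> norm x * C"
  shows "bounded_clinear T"
  unfolding bounded_clinear_def
  by (intro conjI bounded_linear_intro[of T C]) (auto simp: assms scaleR_eq_scaleC)

lemma bounded_clinear_bounded_linear: "bounded_clinear T \<Longrightarrow> bounded_linear T"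
  by (simp add: bounded_clinear_def)

lemma bounded_clinear_scaleC: "bounded_clinear T \<Longrightarrow> T (a *\<^sub>C x) = a *\<^sub>C T x"
  by (simp add: bounded_clinear_def)

lemma bounded_linear_scaleC: "bounded_linear (\<lambda>x. a *\<^sub>C x :: 'a::complex_hilbert)"
  by (rule bounded_linear_intro[of _ "cmod a"])
    (auto simp: scaleC_add_right scaleR_eq_scaleC scaleC_scaleC mult.commute)

lemma bounded_clinear_add:
  assumes "bounded_clinear S" "bounded_clinear T"
  shows "bounded_clinear (\<lambda>x. S x + T x)"
  using assms unfolding bounded_clinear_def
  by (auto intro: bounded_linear_add simp: scaleC_add_right)

lemma bounded_clinear_scale:
  assumes "bounded_clinear T"
  shows "bounded_clinear (\<lambda>x. a *\<^sub>C T x)"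
  using assms unfolding bounded_clinear_def
  by (auto intro: bounded_linear_compose[OF bounded_linear_scaleC] simp: scaleC_scaleC mult.commute)

lemma bounded_clinear_id: "bounded_clinear (\<lambda>x. x)"
  by (simp add: bounded_clinear_def bounded_linear_ident)

lemma bounded_clinear_cadjoint:
  assumes T: "bounded_clinear T"
  shows "bounded_clinear (cadjoint T)"
proof -
  note adj = cadjoint_works[OF T, symmetric]
  obtain C where C: "1 \<le> C" "\<And>x. norm (T x) \<le> C * norm x"
    using bounded_linear_bound_ge_one[OF bounded_clinear_bounded_linear[OF T]] by blast
  show ?thesis
  proof (rule bounded_clinearI[of _ C])
    show "cadjoint T (x + y) = cadjoint T x + cadjoint T y" for x y
      by (rule cinner_eqI) (simp add: cinner_add_right adj)
    show "cadjoint T (a *\<^sub>C x) = a *\<^sub>C cadjoint T x" for a x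
      by (rule cinner_eqI) (simp add: cinner_scaleC_right adj)
    show "norm (cadjoint T x) \<le> norm x * C" for x
    proof -
      have "complex_of_real ((norm (cadjoint T x))\<^sup>2) = cinner (T (cadjoint T x)) x"
        using cinner_self[of "cadjoint T x"] adj[of "cadjoint T x" x] by simp
      then have "(norm (cadjoint T x))\<^sup>2 = cmod (cinner (T (cadjoint T x)) x)"
        by (metis norm_of_real abs_of_nonneg zero_le_power2)
      also have "\<dots> \<le> (C * norm (cadjoint T x)) * norm x"
        by (rule order_trans[OF cinner_Cauchy_Schwarz mult_right_mono[OF C(2)]]) simp
      finally have "norm (cadjoint T x) * norm (cadjoint T x) \<le> norm (cadjoint T x) * (norm x * C)"
        by (simp add: power2_eq_square mult_ac)
      then show ?thesis using C(1) by (cases "norm (cadjoint T x) = 0") auto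
    qed
  qed
qed

lemma cinner_cadjoint_left:
  assumes "bounded_clinear T"
  shows "cinner (cadjoint T x) y = cinner x (T y)"
  by (metis assms cadjoint_works cinner_commute)

text \<open>Real orthogonality to \<open>b\<close> and to \<open>\<i> b\<close> is complex orthogonality to \<open>b\<close>. Hence a vector that is
orthogonal to the finite set is orthogonal to the kernel, so it is the shortest preimage of its image,
and the bounded preimages of a closed range apply to it.\<close>

lemma fredholm_bounded_below_on_finite_codim:
  fixes T :: "'a::complex_hilbert \<Rightarrow> 'a"
  assumes "fredholm T"
  obtains B \<delta> where "finite B" "0 < \<delta>" "\<And>x. \<forall>b\<in>B. inner x b = 0 \<Longrightarrow> \<delta> * norm x \<le> norm (T x)"
proof -
  obtain B where B: "finite B" "{x. T x = 0} \<subseteq> cspan B" and T: "bounded_linear T" and cl: "closed (range T)"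
    using assms by (auto simp: fredholm_def bounded_clinear_def)
  interpret T: bounded_linear T by (rule T)
  obtain C where C: "0 < C" "\<And>x. \<exists>x'. T x' = T x \<and> norm x' \<le> C * norm (T x)"
    using closed_range_bounded_preimage[OF T cl] by blast
  define B' where "B' = B \<union> (\<lambda>b. \<i> *\<^sub>C b) ` B"
  have "inverse C * norm x \<le> norm (T x)" if x: "\<forall>b\<in>B'. inner x b = 0" for x
  proof -
    have xB: "cinner x b = 0" if "b \<in> B" for b
    proof -
      have "inner x b = 0" "inner x (\<i> *\<^sub>C b) = 0" using x that by (auto simp: B'_def)
      then show ?thesis by (simp add: inner_eq_Re_cinner cinner_scaleC_right complex_eq_iff)
    qed
    have perp: "cinner x y = 0" if "y \<in> cspan B" for y
      using that by (induction rule: complex_vector.span_induct_alt)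
        (simp_all add: cinner_add_right cinner_scaleC_right xB)
    obtain x' where x': "T x' = T x" "norm x' \<le> C * norm (T x)" using C by blast
    have "T (x - x') = 0" using x' by (simp add: T.diff)
    then have "inner x (x - x') = 0" using perp B(2) by (auto simp: inner_eq_Re_cinner)
    then have "norm x * norm x = inner x x'"
      by (simp add: inner_diff_right power2_norm_eq_inner[symmetric] power2_eq_square)
    also have "\<dots> \<le> norm x * norm x'" by (rule norm_cauchy_schwarz)
    finally have "norm x \<le> norm x'" by (cases "norm x = 0") auto
    then have "norm x \<le> C * norm (T x)" using x'(2) by simp
    then show ?thesis using C(1) by (simp add: field_simps)
  qed
  moreover have "finite B'" using B(1) by (simp add: B'_def)
  ultimately show ?thesis using that[of B' "inverse C"] C(1) by simp
qed

section \<open>The essential numerical range lies in the open disk\<close>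

text \<open>Suppose the quadratic form of \<open>Re (cnj z N)\<close> comes up to \<open>1\<close> on every subspace of finite
codimension. Then the commuting symmetric operators \<open>H = Re (cnj z N)\<close> and \<open>G = Im (cnj z N)\<close> have joint
approximate eigenvectors with values \<open>h \<ge> 1\<close> and \<open>g\<close> in every subspace of finite codimension. A compact
operator is small on some of these subspaces, so \<open>A - z (h + \<i> g)\<close> is not bounded below on any such subspace, and
\<open>z (h + \<i> g)\<close> is a point of the essential spectrum outside the open disk. Normality of \<open>N\<close> is what makes
\<open>H\<close> and \<open>G\<close> commute.\<close>

lemma real_part_gap_on_finite_codim:
  fixes A N K :: "'a::complex_hilbert \<Rightarrow> 'a"
  assumes normal: "normal_operator N" and compact: "compact_operator K"
    and A: "A = (\<lambda>x. N x + K x)" and ess: "essential_spectrum A \<subseteq> ball 0 1"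
    and z: "cmod z = 1"
  obtains B \<delta> where "finite B" "0 < \<delta>"
    "\<And>x. \<forall>b\<in>B. inner x b = 0 \<Longrightarrow> \<delta> * (norm x)\<^sup>2 \<le> (norm x)\<^sup>2 - Re (cnj z * cinner (A x) x)"
proof -
  have N: "bounded_clinear N" and NN: "N (cadjoint N x) = cadjoint N (N x)" for x
    using normal by (auto simp: normal_operator_def fun_eq_iff)
  define M where "M = cadjoint N"
  have M: "bounded_clinear M" unfolding M_def by (rule bounded_clinear_cadjoint[OF N])
  have K: "bounded_linear K" and Kc: "compact (closure (K ` cball 0 1))"
    using compact by (auto simp: compact_operator_def bounded_clinear_def)
  have Nadj: "cinner (N x) y = cinner x (M y)" and Madj: "cinner (M x) y = cinner x (N y)" for x y
    unfolding M_def by (rule cadjoint_works[OF N], rule cinner_cadjoint_left[OF N])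
  have zz: "z * cnj z = 1" "cnj z * z = 1" using z by (simp_all add: complex_norm_square[symmetric] mult.commute)
  define L where "L a b x = a *\<^sub>C N x + b *\<^sub>C M x" for a b x
  define H where "H = L (cnj z / 2) (z / 2)"
  define G where "G = L (- \<i> * cnj z / 2) (\<i> * z / 2)"
  have Lc: "bounded_clinear (L a b)" for a b
    unfolding L_def by (intro bounded_clinear_scale bounded_clinear_add N M)
  have Hc: "bounded_clinear H" and Gc: "bounded_clinear G" unfolding H_def G_def by (rule Lc)+
  then have H: "bounded_linear H" and G: "bounded_linear G" by (auto simp: bounded_clinear_def)
  interpret H: bounded_linear H by (rule H)
  interpret G: bounded_linear G by (rule G)
  interpret N: bounded_linear N using N by (simp add: bounded_clinear_def)
  interpret M: bounded_linear M using M by (simp add: bounded_clinear_def)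
  have Lsym: "cinner (L a b x) y = cinner x (L (cnj b) (cnj a) y)" for a b x y
    by (simp add: L_def cinner_simps Nadj Madj)
  have Hsym: "inner (H x) y = inner x (H y)" and Gsym: "inner (G x) y = inner x (G y)" for x y
    by (simp_all add: inner_eq_Re_cinner H_def G_def Lsym)
  have Lcomm: "L a b (L c d x) = L c d (L a b x)" for a b c d x
    unfolding L_def
    by (simp add: N.add M.add bounded_clinear_scaleC[OF N] bounded_clinear_scaleC[OF M]
        scaleC_add_right scaleC_scaleC NN[folded M_def] mult_ac add_ac)
  have HG: "G (H x) = H (G x)" for x
    unfolding H_def G_def by (rule Lcomm)
  have HN: "inner (H x) x = Re (cnj z * cinner (N x) x)" for x
  proof -
    have "cinner (M x) x = cnj (cinner (N x) x)" by (metis Madj cinner_commute)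
    then show ?thesis by (simp add: inner_eq_Re_cinner H_def L_def cinner_simps)
  qed
  have Llin: "p *\<^sub>C L a b x + q *\<^sub>C L c d x = L (p * a + q * c) (p * b + q * d) x" for a b c d p q x
    unfolding L_def by (simp add: scaleC_add_right scaleC_add_left scaleC_scaleC add_ac)
  have Ndec: "N x = z *\<^sub>C (H x + \<i> *\<^sub>C G x)" for x
  proof -
    have "z *\<^sub>C (H x + \<i> *\<^sub>C G x) = z *\<^sub>C H x + (z * \<i>) *\<^sub>C G x"
      by (simp add: scaleC_add_right scaleC_scaleC)
    also have "\<dots> = L (z * (cnj z / 2) + (z * \<i>) * (- \<i> * cnj z / 2)) (z * (z / 2) + (z * \<i>) * (\<i> * z / 2)) x"
      unfolding H_def G_def by (rule Llin)
    also have "z * (cnj z / 2) + (z * \<i>) * (- \<i> * cnj z / 2) = z * cnj z"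
      by (simp add: field_simps)
    also have "z * (z / 2) + (z * \<i>) * (\<i> * z / 2) = 0" by (simp add: field_simps)
    finally show ?thesis by (simp add: L_def zz scaleC_one)
  qed
  \<comment> \<open>The zero operator in the place of \<open>T\<close> means that only the quadratic form of \<open>H\<close> is constrained.\<close>
  have not_codim: "\<not> in_every_finite_codim (\<lambda>\<epsilon> x. norm (0::'a) \<le> \<epsilon> \<and> 1 - \<epsilon> \<le> inner (H x) x)"
  proof
    assume c0: "in_every_finite_codim (\<lambda>\<epsilon> x. norm (0::'a) \<le> \<epsilon> \<and> 1 - \<epsilon> \<le> inner (H x) x)"
    obtain h where h: "1 \<le> h" and
      ch: "in_every_finite_codim (\<lambda>\<epsilon> x. norm (0::'a) \<le> \<epsilon> \<and> norm (H x - h *\<^sub>R x) \<le> \<epsilon>)"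
      by (rule approximate_eigenvalue_in_every_finite_codim[OF H bounded_linear_zero Hsym H.zero c0])
    obtain C where C: "1 \<le> C" "\<And>x. norm (G x) \<le> C * norm x"
      using bounded_linear_bound_ge_one[OF G] by blast
    have low: "- C \<le> inner (G x) x" if "norm x = 1" for x
      using Cauchy_Schwarz_ineq2[of "G x" x] C(2)[of x] that by (simp add: abs_le_iff)
    have T: "bounded_linear (\<lambda>x. H x - h *\<^sub>R x)"
      by (intro bounded_linear_sub H bounded_linear_scaleR_right)
    have comm: "G (H x - h *\<^sub>R x) = H (G x) - h *\<^sub>R G x" for x by (simp add: G.diff G.scaleR HG)
    \<comment> \<open>The form of \<open>G\<close> is at least \<open>- C\<close> on unit vectors, which starts the second maximisation.\<close>
    have cC: "in_every_finite_codim (\<lambda>\<epsilon> x. norm (H x - h *\<^sub>R x) \<le> \<epsilon> \<and> - C - \<epsilon> \<le> inner (G x) x)"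
      unfolding in_every_finite_codim_def
    proof (intro allI impI)
      fix B :: "'a set" and \<epsilon> :: real assume B: "finite B" "0 < \<epsilon>"
      obtain x where "norm x = 1" "\<And>b. b \<in> B \<Longrightarrow> inner x b = 0" "norm (H x - h *\<^sub>R x) \<le> \<epsilon>"
        using in_every_finite_codimE[OF ch B] by blast
      then show "\<exists>x. norm x = 1 \<and> (\<forall>b\<in>B. inner x b = 0) \<and>
          norm (H x - h *\<^sub>R x) \<le> \<epsilon> \<and> - C - \<epsilon> \<le> inner (G x) x"
        using low[of x] B(2) by (intro exI[of _ x]) auto
    qed
    obtain g where
      cg: "in_every_finite_codim (\<lambda>\<epsilon> x. norm (H x - h *\<^sub>R x) \<le> \<epsilon> \<and> norm (G x - g *\<^sub>R x) \<le> \<epsilon>)"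
      by (rule approximate_eigenvalue_in_every_finite_codim[OF G T Gsym comm cC])
    define l where "l = z * Complex h g"
    have "1 \<le> cmod l" using h complex_Re_le_cmod[of "Complex h g"] by (simp add: l_def norm_mult z)
    then have "l \<notin> essential_spectrum A" using ess by auto
    then have "fredholm (\<lambda>x. A x - l *\<^sub>C x)" by (simp add: essential_spectrum_def)
    then obtain B1 \<delta> where B1: "finite B1" "0 < \<delta>"
      "\<And>x. \<forall>b\<in>B1. inner x b = 0 \<Longrightarrow> \<delta> * norm x \<le> norm (A x - l *\<^sub>C x)"
      using fredholm_bounded_below_on_finite_codim by blast
    have "0 < \<delta>/4" using B1(2) by simp
    obtain B2 where B2: "finite B2" "\<And>x. \<forall>b\<in>B2. inner x b = 0 \<Longrightarrow> norm (K x) \<le> \<delta>/4 * norm x"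
      using compact_small_on_finite_codim[OF K Kc \<open>0 < \<delta>/4\<close>] by blast
    have "finite (B1 \<union> B2)" using B1 B2 by simp
    from in_every_finite_codimE[OF cg this \<open>0 < \<delta>/4\<close>] obtain x where x: "norm x = 1"
      "\<And>b. b \<in> B1 \<union> B2 \<Longrightarrow> inner x b = 0" "norm (H x - h *\<^sub>R x) \<le> \<delta>/4" "norm (G x - g *\<^sub>R x) \<le> \<delta>/4"
      by blast
    have "A x - l *\<^sub>C x = z *\<^sub>C ((H x - h *\<^sub>R x) + \<i> *\<^sub>C (G x - g *\<^sub>R x)) + K x"
    proof -
      have "Complex h g *\<^sub>C x = h *\<^sub>R x + \<i> *\<^sub>C (g *\<^sub>R x)"
        by (simp add: Complex_eq scaleC_add_left scaleR_eq_scaleC scaleC_scaleC)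
      then have "l *\<^sub>C x = z *\<^sub>C (h *\<^sub>R x + \<i> *\<^sub>C (g *\<^sub>R x))"
        by (simp add: l_def scaleC_scaleC[symmetric])
      then show ?thesis
        unfolding A Ndec[of x]
        by (simp add: complex_vector.scale_right_diff_distrib complex_vector.scale_right_distrib)
    qed
    then have "norm (A x - l *\<^sub>C x) \<le> norm ((H x - h *\<^sub>R x) + \<i> *\<^sub>C (G x - g *\<^sub>R x)) + norm (K x)"
      using norm_triangle_ineq[of "z *\<^sub>C ((H x - h *\<^sub>R x) + \<i> *\<^sub>C (G x - g *\<^sub>R x))" "K x"] by (simp add: z)
    also have "\<dots> \<le> norm (H x - h *\<^sub>R x) + norm (G x - g *\<^sub>R x) + norm (K x)"
      using norm_triangle_ineq[of "H x - h *\<^sub>R x" "\<i> *\<^sub>C (G x - g *\<^sub>R x)"] by simp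
    finally have "norm (A x - l *\<^sub>C x) \<le> 3 * (\<delta>/4)" using x B2(2)[of x] by simp
    moreover have "\<delta> \<le> norm (A x - l *\<^sub>C x)" using B1(3)[of x] x by simp
    ultimately show False using B1(2) by simp
  qed
  then obtain B1 \<epsilon> where B1: "finite B1" "0 < \<epsilon>" and
    less: "\<not> (\<exists>x. norm x = 1 \<and> (\<forall>b\<in>B1. inner x b = 0) \<and> norm (0::'a) \<le> \<epsilon> \<and> 1 - \<epsilon> \<le> inner (H x) x)"
    unfolding in_every_finite_codim_def by blast
  have unit: "inner (H x) x \<le> 1 - \<epsilon>" if "norm x = 1" "\<forall>b\<in>B1. inner x b = 0" for x
    using less that B1(2) by force
  have gapN: "inner (H x) x \<le> (1 - \<epsilon>) * (norm x)\<^sup>2" if x: "\<forall>b\<in>B1. inner x b = 0" for x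
  proof (cases "x = 0")
    case False
    define w where "w = inverse (norm x) *\<^sub>R x"
    have "inner (H w) w \<le> 1 - \<epsilon>" using False x by (intro unit) (auto simp: w_def)
    moreover have "inner (H w) w = inner (H x) x / (norm x)\<^sup>2"
      by (simp add: w_def H.scaleR power2_eq_square divide_simps)
    ultimately show ?thesis using False by (simp add: divide_simps)
  qed simp
  have "0 < \<epsilon>/2" using B1(2) by simp
  obtain B2 where B2: "finite B2" "\<And>x. \<forall>b\<in>B2. inner x b = 0 \<Longrightarrow> norm (K x) \<le> \<epsilon>/2 * norm x"
    using compact_small_on_finite_codim[OF K Kc \<open>0 < \<epsilon>/2\<close>] by blast
  show thesis
  proof (rule that[of "B1 \<union> B2" "\<epsilon>/2"])
    fix x assume x: "\<forall>b\<in>B1 \<union> B2. inner x b = 0"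
    have "Re (cnj z * cinner (K x) x) \<le> cmod (cnj z * cinner (K x) x)" by (rule complex_Re_le_cmod)
    also have "\<dots> \<le> norm (K x) * norm x" using cinner_Cauchy_Schwarz[of "K x" x] by (simp add: norm_mult z)
    also have "\<dots> \<le> \<epsilon>/2 * norm x * norm x" using B2(2)[of x] x by (intro mult_right_mono) auto
    finally have "Re (cnj z * cinner (K x) x) \<le> \<epsilon>/2 * (norm x)\<^sup>2" by (simp add: power2_eq_square)
    moreover have "inner (H x) x \<le> (1 - \<epsilon>) * (norm x)\<^sup>2" using x by (intro gapN) auto
    ultimately show "\<epsilon>/2 * (norm x)\<^sup>2 \<le> (norm x)\<^sup>2 - Re (cnj z * cinner (A x) x)"
      unfolding HN A cinner_add_left distrib_left by (simp add: algebra_simps)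
  qed (use B1 B2 in auto)
qed

section \<open>Positivity after a finite-rank perturbation\<close>

text \<open>Gram-Schmidt orthonormalisation.\<close>

lemma finite_orthonormal_system:
  fixes B :: "'a::complex_hilbert set"
  assumes "finite B"
  shows "\<exists>E. finite E \<and> (\<forall>e\<in>E. norm e = 1) \<and> (\<forall>e\<in>E. \<forall>f\<in>E. e \<noteq> f \<longrightarrow> cinner e f = 0) \<and>
    (\<forall>x. (\<forall>e\<in>E. cinner x e = 0) \<longrightarrow> (\<forall>b\<in>B. cinner x b = 0))"
  using assms
proof (induction B)
  case empty
  show ?case by (intro exI[of _ "{}"]) simp
next
  case (insert b B)
  then obtain E where E: "finite E" "\<And>e. e \<in> E \<Longrightarrow> norm e = 1"
      "\<And>e f. e \<in> E \<Longrightarrow> f \<in> E \<Longrightarrow> e \<noteq> f \<Longrightarrow> cinner e f = 0"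
      "\<And>x c. (\<And>e. e \<in> E \<Longrightarrow> cinner x e = 0) \<Longrightarrow> c \<in> B \<Longrightarrow> cinner x c = 0" by metis
  define u where "u = b - (\<Sum>e\<in>E. cinner b e *\<^sub>C e)"
  have uE: "cinner u f = 0" if f: "f \<in> E" for f
  proof -
    have "(\<Sum>e\<in>E. cinner b e * cinner e f) = (\<Sum>e\<in>E. if e = f then cinner b f else 0)"
      using E f by (intro sum.cong) (auto simp: cinner_self)
    then show ?thesis using E(1) f by (simp add: u_def cinner_diff_left cinner_sum_left cinner_scaleC_left)
  qed
  have bE: "cinner x b = cinner x u" if "\<And>e. e \<in> E \<Longrightarrow> cinner x e = 0" for x
    using that by (simp add: u_def cinner_diff_right cinner_sum_right cinner_scaleC_right)
  show ?case
  proof (cases "u = 0")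
    case True
    then have "cinner x c = 0" if "\<And>e. e \<in> E \<Longrightarrow> cinner x e = 0" "c \<in> insert b B" for x c
      using that bE[of x] E(4)[of x c] by auto
    then show ?thesis using E(1,2,3) by (intro exI[of _ E]) blast
  next
    case False
    define w where "w = inverse (norm u) *\<^sub>R u"
    have w1: "norm w = 1" using False by (simp add: w_def)
    have uw: "u = norm u *\<^sub>R w" using False by (simp add: w_def)
    have wE: "cinner w f = 0" "cinner f w = 0" if "f \<in> E" for f
      using uE[OF that] cinner_commute[of f u] by (simp_all add: w_def cinner_simps)
    have bw: "cinner x b = 0" if "\<And>e. e \<in> insert w E \<Longrightarrow> cinner x e = 0" for x
      using bE[of x] that cinner_scaleR_right[of x "norm u" w] by (simp add: uw[symmetric])
    have span: "cinner x c = 0" if "\<And>e. e \<in> insert w E \<Longrightarrow> cinner x e = 0" "c \<in> insert b B" for x c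
      using that bw[of x] E(4)[of x c] by auto
    have orth: "cinner e f = 0" if "e \<in> insert w E" "f \<in> insert w E" "e \<noteq> f" for e f
      using that wE E(3) by auto
    show ?thesis
    proof (intro exI[of _ "insert w E"] conjI ballI allI impI)
      show "norm e = 1" if "e \<in> insert w E" for e using that E(2) w1 by auto
    qed (use E(1) orth span in \<open>blast+\<close>)
  qed
qed

lemma cinner_le_of_numerical_range:
  fixes A :: "'a::complex_hilbert \<Rightarrow> 'a"
  assumes A: "bounded_clinear A" and W: "numerical_range A \<subseteq> cball 0 1"
  shows "cmod (cinner (A x) x) \<le> (norm x)\<^sup>2"
proof (cases "x = 0")
  case False
  interpret A: bounded_linear A using A by (simp add: bounded_clinear_def)
  define w where "w = inverse (norm x) *\<^sub>R x"
  have "norm w = 1" using False by (simp add: w_def)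
  then have "cinner (A w) w \<in> numerical_range A" by (auto simp: numerical_range_def)
  then have "cmod (cinner (A w) w) \<le> 1" using W by auto
  moreover have "cinner (A w) w = cinner (A x) x / of_real ((norm x)\<^sup>2)"
    by (simp add: w_def A.scaleR cinner_simps power2_eq_square divide_simps)
  ultimately show ?thesis using False by (simp add: norm_divide norm_power divide_simps)
qed (use A in \<open>simp add: bounded_clinear_def linear_simps\<close>)

text \<open>Let \<open>q x = \<parallel>x\<parallel>\<^sup>2 - Re (cnj z \<langle>A x, x\<rangle>)\<close>, and let \<open>p\<close> be the projection of \<open>x\<close> to the span of an orthonormal
system whose complement is contained in the subspace where \<open>q\<close> is coercive. Since \<open>q\<close> is nonnegative, the
parallelogram law bounds \<open>q (x - p)\<close> by \<open>2 q x + 2 q p\<close>. Here \<open>q p \<le> 2 \<parallel>p\<parallel>\<^sup>2\<close>, and \<open>\<parallel>p\<parallel>\<^sup>2\<close> is the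
added sum.\<close>

lemma coercive_after_finite_rank_perturbation:
  fixes A :: "'a::complex_hilbert \<Rightarrow> 'a"
  assumes A: "bounded_clinear A" and W: "numerical_range A \<subseteq> cball 0 1" and z: "cmod z = 1"
    and B: "finite B" and \<delta>: "0 < \<delta>"
    and gap: "\<And>x. \<forall>b\<in>B. inner x b = 0 \<Longrightarrow> \<delta> * (norm x)\<^sup>2 \<le> (norm x)\<^sup>2 - Re (cnj z * cinner (A x) x)"
  shows "\<exists>(n::nat) e \<kappa>. 0 < \<kappa> \<and> (\<forall>i<n. norm (e i) = 1) \<and> (\<forall>x. \<kappa> * (norm x)\<^sup>2 \<le>
    (norm x)\<^sup>2 - Re (cnj z * cinner (A x) x) + (\<Sum>i<n. (cmod (cinner x (e i)))\<^sup>2))"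
proof -
  obtain E where E: "finite E" "\<And>e. e \<in> E \<Longrightarrow> norm e = 1"
      "\<And>e f. e \<in> E \<Longrightarrow> f \<in> E \<Longrightarrow> e \<noteq> f \<Longrightarrow> cinner e f = 0"
      "\<And>x b. (\<And>e. e \<in> E \<Longrightarrow> cinner x e = 0) \<Longrightarrow> b \<in> B \<Longrightarrow> cinner x b = 0"
    using finite_orthonormal_system[OF B] by metis
  interpret A: bounded_linear A using A by (simp add: bounded_clinear_def)
  define q where "q x = (norm x)\<^sup>2 - Re (cnj z * cinner (A x) x)" for x
  have absq: "\<bar>Re (cnj z * cinner (A x) x)\<bar> \<le> (norm x)\<^sup>2" for x
    using order_trans[OF abs_Re_le_cmod[of "cnj z * cinner (A x) x"]]
      cinner_le_of_numerical_range[OF A W, of x] by (simp add: norm_mult z)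
  have q0: "0 \<le> q x" and q2: "q x \<le> 2 * (norm x)\<^sup>2" for x
    using absq[of x] by (auto simp: q_def)
  have par: "q (x - y) + q (x + y) = 2 * q x + 2 * q y" for x y
    unfolding q_def power2_norm_eq_inner
    by (simp add: A.add A.diff cinner_simps inner_simps algebra_simps)
  define \<kappa> where "\<kappa> = 1 / (6/\<delta> + 1)"
  have \<kappa>: "0 < \<kappa>" using \<delta> by (simp add: \<kappa>_def add_pos_pos)
  have main: "\<kappa> * (norm x)\<^sup>2 \<le> q x + (\<Sum>e\<in>E. (cmod (cinner x e))\<^sup>2)" for x
  proof -
    define p where "p = (\<Sum>e\<in>E. cinner x e *\<^sub>C e)"
    define y where "y = x - p"
    have yE: "cinner y f = 0" if f: "f \<in> E" for f
    proof -
      have "(\<Sum>e\<in>E. cinner x e * cinner e f) = (\<Sum>e\<in>E. if e = f then cinner x f else 0)"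
        using E f by (intro sum.cong) (auto simp: cinner_self)
      then show ?thesis using E(1) f by (simp add: y_def p_def cinner_diff_left cinner_sum_left cinner_scaleC_left)
    qed
    have yp: "cinner y p = 0" unfolding p_def using yE by (simp add: cinner_sum_right cinner_scaleC_right)
    have "complex_of_real ((norm p)\<^sup>2) = cinner x p"
      using yp cinner_self[of p] by (simp add: y_def cinner_diff_left)
    also have "\<dots> = (\<Sum>e\<in>E. cnj (cinner x e) * cinner x e)"
      by (simp add: p_def cinner_sum_right cinner_scaleC_right)
    also have "\<dots> = complex_of_real (\<Sum>e\<in>E. (cmod (cinner x e))\<^sup>2)"
      unfolding of_real_sum by (intro sum.cong refl) (metis complex_norm_square mult.commute)
    finally have np: "(norm p)\<^sup>2 = (\<Sum>e\<in>E. (cmod (cinner x e))\<^sup>2)" by (simp only: of_real_eq_iff)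
    have "inner y p = 0" using yp by (simp add: inner_eq_Re_cinner)
    then have nx: "(norm x)\<^sup>2 = (norm y)\<^sup>2 + (norm p)\<^sup>2"
      unfolding y_def power2_norm_eq_inner by (simp add: inner_simps inner_commute)
    have "\<forall>b\<in>B. inner y b = 0" using E(4)[OF yE] by (auto simp: inner_eq_Re_cinner)
    then have "\<delta> * (norm y)\<^sup>2 \<le> q y" using gap by (simp add: q_def)
    also have "\<dots> \<le> 2 * q x + 4 * (norm p)\<^sup>2"
      using par[of x p] q0[of "x + p"] q2[of p] by (simp add: y_def)
    finally have "(norm y)\<^sup>2 \<le> (2 * q x + 4 * (norm p)\<^sup>2) / \<delta>" using \<delta> by (simp add: field_simps)
    then have "(norm x)\<^sup>2 \<le> (2 * q x + 4 * (norm p)\<^sup>2) / \<delta> + (norm p)\<^sup>2" using nx by simp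
    also have "\<dots> \<le> (6 * q x + 6 * (norm p)\<^sup>2) / \<delta> + (q x + (norm p)\<^sup>2)"
      using q0[of x] \<delta> by (intro add_mono divide_right_mono) auto
    also have "\<dots> = (6/\<delta> + 1) * (q x + (norm p)\<^sup>2)" using \<delta> by (simp add: field_simps)
    finally have "(norm x)\<^sup>2 \<le> (6/\<delta> + 1) * (q x + (norm p)\<^sup>2)" .
    then have "(norm x)\<^sup>2 / (6/\<delta> + 1) \<le> q x + (norm p)\<^sup>2"
      using \<delta> by (subst pos_divide_le_eq) (auto simp: add_pos_pos mult.commute)
    then show ?thesis by (simp add: \<kappa>_def np)
  qed
  obtain h where h: "bij_betw h {0..<card E} E" using ex_bij_betw_nat_finite[OF E(1)] by blast
  have "(\<Sum>e\<in>E. (cmod (cinner x e))\<^sup>2) = (\<Sum>i<card E. (cmod (cinner x (h i)))\<^sup>2)" for x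
    using sum.reindex_bij_betw[OF h, of "\<lambda>e. (cmod (cinner x e))\<^sup>2"] by (simp add: atLeast0LessThan)
  moreover have "norm (h i) = 1" if "i < card E" for i
    using E(2) bij_betwE[OF h] that by auto
  ultimately show ?thesis
    using \<kappa> main by (intro exI[of _ "card E"] exI[of _ h] exI[of _ \<kappa>]) (simp add: q_def)
qed

text \<open>The Lax-Milgram theorem: for a small step \<open>t\<close> the map \<open>x \<mapsto> x - t (R x - y)\<close> is a contraction, and its
fixed point solves the equation.\<close>

lemma coercive_surjective:
  fixes R :: "'a::{real_inner,complete_space} \<Rightarrow> 'a"
  assumes R: "bounded_linear R" and \<kappa>: "0 < \<kappa>" and coer: "\<And>x. \<kappa> * (norm x)\<^sup>2 \<le> inner (R x) x"
  shows "\<exists>x. R x = y"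
proof -
  interpret R: bounded_linear R by (rule R)
  obtain C0 where C0: "1 \<le> C0" "\<And>x. norm (R x) \<le> C0 * norm x"
    using bounded_linear_bound_ge_one[OF R] by blast
  define C where "C = max C0 \<kappa>"
  have C: "0 < C" "\<kappa> \<le> C" "norm (R x) \<le> C * norm x" for x
    using C0 \<kappa> mult_right_mono[of C0 C "norm x"] by (auto simp: C_def intro: order_trans[OF C0(2)])
  \<comment> \<open>This step minimises the Lipschitz bound \<open>1 - 2 t \<kappa> + t\<^sup>2 C\<^sup>2\<close>.\<close>
  define t where "t = \<kappa> / C\<^sup>2"
  have t: "0 < t" using \<kappa> C by (simp add: t_def)
  define c where "c = sqrt (1 - \<kappa>\<^sup>2 / C\<^sup>2)"
  have "\<kappa>\<^sup>2 / C\<^sup>2 \<le> 1" using C \<kappa> power_mono[of \<kappa> C 2] by simp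
  then have c2: "c\<^sup>2 = 1 - \<kappa>\<^sup>2 / C\<^sup>2" and c0: "0 \<le> c" by (simp_all add: c_def)
  have c1: "c < 1" unfolding c_def using \<kappa> C by simp
  define f where "f x = x - t *\<^sub>R (R x - y)" for x
  have "dist (f a) (f b) \<le> c * dist a b" for a b
  proof -
    define u where "u = a - b"
    have fab: "f a - f b = u - t *\<^sub>R R u" by (simp add: f_def u_def R.diff algebra_simps)
    have "(norm (f a - f b))\<^sup>2 = (norm u)\<^sup>2 - 2 * t * inner (R u) u + t\<^sup>2 * (norm (R u))\<^sup>2"
      unfolding fab power2_norm_eq_inner
      by (simp add: inner_simps inner_commute power2_eq_square algebra_simps)
    also have "\<dots> \<le> (norm u)\<^sup>2 - 2 * t * (\<kappa> * (norm u)\<^sup>2) + t\<^sup>2 * (C * norm u)\<^sup>2"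
      using coer[of u] C(3)[of u] t
      by (intro add_mono diff_mono mult_left_mono power_mono) auto
    also have "\<dots> = (1 - 2 * t * \<kappa> + t\<^sup>2 * C\<^sup>2) * (norm u)\<^sup>2" by (simp add: algebra_simps)
    also have "1 - 2 * t * \<kappa> + t\<^sup>2 * C\<^sup>2 = c\<^sup>2"
      unfolding c2 t_def using C(1) by (simp add: field_simps power2_eq_square)
    finally have "(norm (f a - f b))\<^sup>2 \<le> (c * norm u)\<^sup>2" by (simp add: power_mult_distrib)
    then have "norm (f a - f b) \<le> c * norm u" using c0 by (simp add: power2_le_iff_abs_le)
    then show ?thesis by (simp add: dist_norm u_def)
  qed
  then obtain x where "f x = x" using banach_fix_type[OF c0 c1, of f] by auto
  then have "R x = y" using t by (simp add: f_def)
  then show ?thesis by blast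
qed

text \<open>For a positive operator a small quadratic form forces a small image. The form is nonnegative at
\<open>x - t M x\<close>; the choice \<open>t = 1 / C\<close> gives the bound.\<close>

lemma semidefinite_norm_bound:
  fixes M :: "'a::real_inner \<Rightarrow> 'a"
  assumes M: "bounded_linear M" and sym: "\<And>x y. inner (M x) y = inner x (M y)"
    and pos: "\<And>x. 0 \<le> inner (M x) x" and C: "0 < C" "\<And>x. norm (M x) \<le> C * norm x"
  shows "(norm (M x))\<^sup>2 \<le> C * inner (M x) x"
proof -
  interpret M: bounded_linear M by (rule M)
  define u where "u = M x"
  define t where "t = 1 / C"
  have "inner (M u) u \<le> C * norm u * norm u"
    by (rule order_trans[OF norm_cauchy_schwarz mult_right_mono[OF C(2)]]) simp
  then have Mu: "t\<^sup>2 * inner (M u) u \<le> t\<^sup>2 * (C * (norm u)\<^sup>2)"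
    by (intro mult_left_mono) (auto simp: power2_eq_square mult_ac)
  have "inner (M u) x = inner u u" using sym[of u x] by (simp add: u_def)
  then have "inner (M (x - t *\<^sub>R u)) (x - t *\<^sub>R u) = inner (M x) x - 2 * t * (norm u)\<^sup>2 + t\<^sup>2 * inner (M u) u"
    unfolding power2_norm_eq_inner
    by (simp add: M.diff M.scaleR inner_simps u_def[symmetric] power2_eq_square algebra_simps)
  with pos[of "x - t *\<^sub>R u"] Mu have "0 \<le> inner (M x) x - 2 * t * (norm u)\<^sup>2 + t\<^sup>2 * (C * (norm u)\<^sup>2)" by linarith
  also have "t\<^sup>2 * (C * (norm u)\<^sup>2) = t * (norm u)\<^sup>2" using C(1) by (simp add: t_def power2_eq_square)
  finally have "t * (norm u)\<^sup>2 \<le> inner (M x) x" by simp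
  then show ?thesis using C(1) by (simp add: t_def u_def field_simps)
qed

section \<open>Analytic dependence and the determinant of a finite-rank perturbation\<close>

lemma bounded_linear_scaleC_left: "bounded_linear (\<lambda>c. c *\<^sub>C (y::'a::complex_hilbert))"
  by (rule bounded_linear_intro[of _ "norm y"])
    (auto simp: scaleC_add_left scaleC_scaleC scaleR_eq_scaleC scaleC_complex_def)

text \<open>With \<open>u = U z e\<close> and \<open>v w = L1 u + (w + z) L2 u\<close> the resolvent identity reads
\<open>U w e - u = - (w - z) U w (v w)\<close>, and \<open>U w (v w)\<close> tends to \<open>a = U z (v z)\<close> because \<open>R w\<close> maps the
difference \<open>U w (v w) - a\<close> to \<open>v w - R w a\<close>, which tends to \<open>v z - R z a = 0\<close>, and is bounded below
uniformly in \<open>w\<close>.\<close>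

lemma holomorphic_inverse_of_quadratic_pencil:
  fixes L0 L1 L2 :: "'a::complex_hilbert \<Rightarrow> 'a" and U :: "complex \<Rightarrow> 'a \<Rightarrow> 'a"
  defines "R \<equiv> \<lambda>z x. L0 x + z *\<^sub>C L1 x + z\<^sup>2 *\<^sub>C L2 x"
  assumes "open S" and lin: "bounded_clinear L0" "bounded_clinear L1" "bounded_clinear L2"
    and \<kappa>: "0 < \<kappa>" and below: "\<And>z x. z \<in> S \<Longrightarrow> \<kappa> * norm x \<le> norm (R z x)"
    and RU: "\<And>z y. z \<in> S \<Longrightarrow> R z (U z y) = y"
  shows "(\<lambda>z. cinner (U z e) f) holomorphic_on S"
proof -
  have Rlin: "bounded_clinear (R z)" for z
    unfolding R_def by (intro bounded_clinear_add bounded_clinear_scale lin)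
  have Rdiff: "R z (x - y) = R z x - R z y" for x y z
    using Rlin[of z] by (simp add: bounded_clinear_def linear_simps)
  have Rscale: "R z (a *\<^sub>C x) = a *\<^sub>C R z x" for a x z
    by (rule bounded_clinear_scaleC[OF Rlin])
  have "\<exists>D. ((\<lambda>z. cinner (U z e) f) has_field_derivative D) (at z)" if z: "z \<in> S" for z
  proof -
    define u where "u = U z e"
    define v where "v w = L1 u + (w + z) *\<^sub>C L2 u" for w
    define a where "a = U z (v z)"
    have quot: "U w e - u = (- (w - z)) *\<^sub>C U w (v w)" if w: "w \<in> S" for w
    proof -
      have "R w (U w e - u) = R z u - R w u" using RU[OF z] RU[OF w] by (simp add: Rdiff u_def)
      also have "\<dots> = (- (w - z)) *\<^sub>C v w"
        unfolding R_def v_def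
        by (simp add: scaleC_add_right scaleC_scaleC algebra_simps power2_eq_square
            complex_vector.scale_left_diff_distrib)
      also have "\<dots> = R w ((- (w - z)) *\<^sub>C U w (v w))" by (simp only: Rscale RU[OF w])
      finally have "R w ((U w e - u) - (- (w - z)) *\<^sub>C U w (v w)) = 0" by (simp only: Rdiff diff_self)
      then have "(U w e - u) - (- (w - z)) *\<^sub>C U w (v w) = 0"
        using below[OF w, of "(U w e - u) - (- (w - z)) *\<^sub>C U w (v w)"] \<kappa> by (simp add: mult_le_0_iff)
      then show ?thesis by simp
    qed
    have bound: "norm (U w (v w) - a) \<le> norm (v w - R w a) / \<kappa>" if w: "w \<in> S" for w
      using below[OF w, of "U w (v w) - a"] \<kappa> RU[OF w] by (simp add: Rdiff field_simps)
    have contC: "isCont (\<lambda>w. g w *\<^sub>C (y::'a)) z" if "isCont g z" for g and y :: 'a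
      using bounded_linear.isCont[OF bounded_linear_scaleC_left] that by blast
    have "isCont (\<lambda>w. norm (v w - R w a) / \<kappa>) z"
      unfolding v_def R_def using \<kappa> by (intro continuous_intros contC) auto
    then have "((\<lambda>w. norm (v w - R w a) / \<kappa>) \<longlongrightarrow> norm (v z - R z a) / \<kappa>) (at z)"
      by (simp add: isCont_def)
    then have lim0: "((\<lambda>w. norm (v w - R w a) / \<kappa>) \<longlongrightarrow> 0) (at z)" using RU[OF z] by (simp add: a_def)
    have inS: "eventually (\<lambda>w. w \<in> S) (at z)" using \<open>open S\<close> z by (rule eventually_at_in_open')
    have "((\<lambda>w. U w (v w) - a) \<longlongrightarrow> 0) (at z)"
      by (rule Lim_null_comparison[OF _ lim0]) (use inS bound in \<open>auto elim: eventually_mono\<close>)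
    then have "((\<lambda>w. norm (U w (v w) - a) * norm f) \<longlongrightarrow> 0) (at z)"
      by (intro tendsto_mult_left_zero tendsto_norm_zero)
    then have "((\<lambda>w. cinner (U w (v w) - a) f) \<longlongrightarrow> 0) (at z)"
      by (rule Lim_null_comparison[rotated]) (simp add: cinner_Cauchy_Schwarz)
    then have "((\<lambda>w. - cinner (U w (v w)) f) \<longlongrightarrow> - cinner a f) (at z)"
      by (intro tendsto_minus) (simp add: cinner_diff_left LIM_zero_iff)
    moreover have "eventually (\<lambda>w. - cinner (U w (v w)) f = (cinner (U w e) f - cinner (U z e) f) / (w - z)) (at z)"
    proof (use inS eventually_neq_at_within in eventually_elim)
      fix w assume w: "w \<in> S" "w \<noteq> z"
      have "cinner (U w e) f - cinner (U z e) f = (- (w - z)) * cinner (U w (v w)) f"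
        using arg_cong[OF quot[OF w(1)], of "\<lambda>x. cinner x f"]
        by (simp only: cinner_diff_left cinner_scaleC_left u_def)
      then show "- cinner (U w (v w)) f = (cinner (U w e) f - cinner (U z e) f) / (w - z)"
        using w(2) by (simp add: field_simps)
    qed
    ultimately have "((\<lambda>w. (cinner (U w e) f - cinner (U z e) f) / (w - z)) \<longlongrightarrow> - cinner a f) (at z)"
      by (rule Lim_transform_eventually)
    then show ?thesis unfolding has_field_derivative_iff by blast
  qed
  then show ?thesis using \<open>open S\<close>
    by (auto simp: holomorphic_on_open)
qed

text \<open>A solution of \<open>R x = \<Sum>i. \<langle>x, e i\<rangle> e i\<close> is determined by its coefficients \<open>c i = \<langle>x, e i\<rangle>\<close>, since then
\<open>x = \<Sum>j. c j U (e j)\<close>. Taking inner products with \<open>e i\<close> again turns the equation into a finite linear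
system for \<open>c\<close>.\<close>

lemma kernel_iff_det_eq_zero:
  fixes R U :: "'a::complex_hilbert \<Rightarrow> 'a" and e :: "nat \<Rightarrow> 'a"
  assumes R: "bounded_clinear R" and inj: "\<And>x. R x = 0 \<Longrightarrow> x = 0" and RU: "\<And>y. R (U y) = y"
  shows "(\<exists>x. x \<noteq> 0 \<and> R x = (\<Sum>i<n. cinner x (e i) *\<^sub>C e i)) \<longleftrightarrow>
    det (mat n n (\<lambda>(i, j). (if i = j then 1 else 0) - cinner (U (e j)) (e i))) = 0"
    (is "?L \<longleftrightarrow> det ?G = 0")
proof -
  interpret R: bounded_linear R using R by (simp add: bounded_clinear_def)
  define syn where "syn c = (\<Sum>j<n. c j *\<^sub>C U (e j))" for c
  have Rsyn: "R (syn c) = (\<Sum>j<n. c j *\<^sub>C e j)" for c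
    by (simp add: syn_def R.sum bounded_clinear_scaleC[OF R] RU)
  have row: "(?G *\<^sub>v vec n c) $ i = c i - cinner (syn c) (e i)" if i: "i < n" for i c
  proof -
    have "(?G *\<^sub>v vec n c) $ i = (\<Sum>j<n. ((if i = j then 1 else 0) - cinner (U (e j)) (e i)) * c j)"
      using i by (simp add: scalar_prod_def atLeast0LessThan)
    also have "\<dots> = (\<Sum>j<n. if i = j then c j else 0) - (\<Sum>j<n. cinner (U (e j)) (e i) * c j)"
      unfolding sum_subtractf[symmetric] by (intro sum.cong) (auto simp: algebra_simps)
    also have "(\<Sum>j<n. if i = j then c j else 0) = c i" using i by simp
    also have "(\<Sum>j<n. cinner (U (e j)) (e i) * c j) = cinner (syn c) (e i)"
      by (simp add: syn_def cinner_sum_left cinner_scaleC_left mult.commute)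
    finally show ?thesis .
  qed
  have ker: "?G *\<^sub>v vec n c = 0\<^sub>v n \<longleftrightarrow> (\<forall>i<n. cinner (syn c) (e i) = c i)" for c
    using row[of _ c] by (auto simp: vec_eq_iff)
  have "?L \<longleftrightarrow> (\<exists>c. (\<exists>i<n. c i \<noteq> 0) \<and> (\<forall>i<n. cinner (syn c) (e i) = c i))"
  proof
    assume ?L
    then obtain x where x: "x \<noteq> 0" "R x = (\<Sum>i<n. cinner x (e i) *\<^sub>C e i)" by blast
    define c where "c i = cinner x (e i)" for i
    have "R (x - syn c) = 0" by (simp add: R.diff Rsyn x(2) c_def)
    then have xs: "x = syn c" using inj by fastforce
    have "\<exists>i<n. c i \<noteq> 0"
    proof (rule ccontr)
      assume "\<not> ?thesis"
      then have "syn c = 0" by (simp add: syn_def)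
      then show False using x(1) xs by simp
    qed
    moreover have "\<forall>i<n. cinner (syn c) (e i) = c i" by (simp add: xs[symmetric] c_def)
    ultimately show "\<exists>c. (\<exists>i<n. c i \<noteq> 0) \<and> (\<forall>i<n. cinner (syn c) (e i) = c i)" by blast
  next
    assume "\<exists>c. (\<exists>i<n. c i \<noteq> 0) \<and> (\<forall>i<n. cinner (syn c) (e i) = c i)"
    then obtain c i where c: "i < n" "c i \<noteq> 0" "\<And>i. i < n \<Longrightarrow> cinner (syn c) (e i) = c i" by blast
    have "syn c \<noteq> 0" using c(1,2) c(3)[of i] by auto
    moreover have "R (syn c) = (\<Sum>i<n. cinner (syn c) (e i) *\<^sub>C e i)" by (simp add: Rsyn c(3))
    ultimately show ?L by blast
  qed
  also have "\<dots> \<longleftrightarrow> (\<exists>v. v \<in> carrier_vec n \<and> v \<noteq> 0\<^sub>v n \<and> ?G *\<^sub>v v = 0\<^sub>v n)"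
  proof
    assume "\<exists>c. (\<exists>i<n. c i \<noteq> 0) \<and> (\<forall>i<n. cinner (syn c) (e i) = c i)"
    then obtain c where c: "\<exists>i<n. c i \<noteq> 0" "?G *\<^sub>v vec n c = 0\<^sub>v n" using ker by blast
    have "vec n c \<noteq> 0\<^sub>v n" using c(1) by (auto simp: vec_eq_iff)
    then show "\<exists>v. v \<in> carrier_vec n \<and> v \<noteq> 0\<^sub>v n \<and> ?G *\<^sub>v v = 0\<^sub>v n"
      using c(2) vec_carrier by blast
  next
    assume "\<exists>v. v \<in> carrier_vec n \<and> v \<noteq> 0\<^sub>v n \<and> ?G *\<^sub>v v = 0\<^sub>v n"
    then obtain v where v: "v \<in> carrier_vec n" "v \<noteq> 0\<^sub>v n" "?G *\<^sub>v v = 0\<^sub>v n" by blast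
    define c where "c i = v $ i" for i
    have vc: "v = vec n c" using v(1) by (auto simp: vec_eq_iff c_def)
    have "\<exists>i<n. c i \<noteq> 0" using v(2) unfolding vc by (auto simp: vec_eq_iff)
    then show "\<exists>c. (\<exists>i<n. c i \<noteq> 0) \<and> (\<forall>i<n. cinner (syn c) (e i) = c i)"
      using v(3) ker[of c] unfolding vc by blast
  qed
  also have "\<dots> \<longleftrightarrow> det ?G = 0" by (rule det_0_iff_vec_prod_zero[symmetric]) simp
  finally show ?thesis .
qed

lemma holomorphic_on_det:
  fixes g :: "nat \<Rightarrow> nat \<Rightarrow> complex \<Rightarrow> complex"
  assumes "\<And>i j. i < n \<Longrightarrow> j < n \<Longrightarrow> g i j holomorphic_on S"
  shows "(\<lambda>z. det (mat n n (\<lambda>(i, j). g i j z))) holomorphic_on S"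
proof -
  have in_range: "p i < n" if "p permutes {0..<n}" "i < n" for p i
    using permutes_in_image[OF that(1), of i] that(2) by simp
  have "(\<lambda>z. \<Sum>p | p permutes {0..<n}. signof p * (\<Prod>i = 0..<n. g i (p i) z)) holomorphic_on S"
    by (intro holomorphic_intros) (auto intro!: assms simp: in_range)
  moreover have "det (mat n n (\<lambda>(i, j). g i j z)) =
      (\<Sum>p | p permutes {0..<n}. signof p * (\<Prod>i = 0..<n. g i (p i) z))" for z
    unfolding det_def'[OF mat_carrier]
    by (intro sum.cong refl arg_cong2[where f="(*)"] prod.cong) (auto simp: in_range)
  ultimately show ?thesis by simp
qed

section \<open>Convexity of the numerical range\<close>

text \<open>The Toeplitz-Hausdorff theorem. The values \<open>a\<close> and \<open>b\<close> are moved to \<open>0\<close> and \<open>1\<close> by an affine map. Multiplying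
\<open>x\<close> by a unimodular \<open>c\<close> makes the mixed terms of the form on \<open>u s = (1 - s) c x + s y\<close> real, so the
normalised form is a continuous real function on the segment, and it takes all values between \<open>0\<close> and \<open>1\<close>.\<close>

lemma convex_numerical_range:
  fixes A :: "'a::complex_hilbert \<Rightarrow> 'a"
  assumes A: "bounded_clinear A"
  shows "convex (numerical_range A)"
proof (rule convexI)
  fix a b and l t :: real
  assume ab: "a \<in> numerical_range A" "b \<in> numerical_range A" and lt: "0 \<le> l" "0 \<le> t" "l + t = 1"
  have l: "l = 1 - t" and t: "0 \<le> t" "t \<le> 1" using lt by auto
  show "l *\<^sub>R a + t *\<^sub>R b \<in> numerical_range A"
  proof (cases "a = b")
    case True
    then have "l *\<^sub>R a + t *\<^sub>R b = a" by (simp add: l scaleR_left_diff_distrib)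
    then show ?thesis using ab by simp
  next
    case False
    interpret A: bounded_linear A using A by (simp add: bounded_clinear_def)
    note AC = bounded_clinear_scaleC[OF A]
    obtain x where x: "norm x = 1" "cinner (A x) x = a" using ab(1) by (auto simp: numerical_range_def)
    obtain y where y: "norm y = 1" "cinner (A y) y = b" using ab(2) by (auto simp: numerical_range_def)
    define d where "d = b - a"
    have d: "d \<noteq> 0" using False by (simp add: d_def)
    define p where "p = (cinner (A x) y - a * cinner x y) / d"
    define q where "q = (cinner (A y) x - a * cinner y x) / d"
    obtain c where c: "cmod c = 1" "Im (c * p + cnj c * q) = 0"
    proof (cases "p - cnj q = 0")
      case True
      then have "p = cnj q" by simp
      then show ?thesis using that[of 1] by simp
    next
      case False
      define w where "w = p - cnj q"
      define c where "c = cnj (sgn w)"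
      have "cmod c = 1" using False by (simp add: c_def w_def norm_sgn)
      moreover have "cnj w * w = of_real ((cmod w)\<^sup>2)"
        by (metis complex_norm_square mult.commute)
      then have "c * w = of_real ((cmod w)\<^sup>2) / of_real (cmod w)"
        by (simp add: c_def sgn_eq)
      then have "Im (c * (p - cnj q)) = 0" by (simp add: w_def[symmetric] flip: of_real_divide of_real_power)
      then have "Im (c * p + cnj c * q) = 0" by (simp add: algebra_simps)
      ultimately show ?thesis using that by blast
    qed
    define k where "k = Re (c * p + cnj c * q)"
    have k: "c * p + cnj c * q = of_real k" using c(2) by (simp add: complex_eq_iff k_def)
    define u where "u s = (1 - s) *\<^sub>R (c *\<^sub>C x) + s *\<^sub>R y" for s :: real
    have cc: "c * cnj c = 1" using c(1) by (simp add: complex_norm_square[symmetric])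
    have Au: "A (u s) = (1 - s) *\<^sub>R (c *\<^sub>C A x) + s *\<^sub>R A y" for s
      by (simp only: u_def A.add A.scaleR AC)
    have form: "cinner (A (u s)) (u s) - a * cinner (u s) (u s) = d * of_real ((1 - s) * s * k + s\<^sup>2)" for s
    proof -
      have "cinner (A (u s)) (u s) - a * cinner (u s) (u s) =
          (1 - s)\<^sup>2 * (c * cnj c) * (cinner (A x) x - a * cinner x x) +
          of_real ((1 - s) * s) * (c * (cinner (A x) y - a * cinner x y) + cnj c * (cinner (A y) x - a * cinner y x)) +
          of_real (s\<^sup>2) * (cinner (A y) y - a * cinner y y)"
        unfolding Au unfolding u_def by (simp only: cinner_simps) (simp add: power2_eq_square algebra_simps)
      also have "cinner (A x) x - a * cinner x x = 0" using x by (simp add: cinner_self)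
      also have "cinner (A y) y - a * cinner y y = d" using y by (simp add: cinner_self d_def)
      also have "c * (cinner (A x) y - a * cinner x y) + cnj c * (cinner (A y) x - a * cinner y x) = d * of_real k"
        unfolding k[symmetric] using d by (simp add: p_def q_def field_simps)
      finally show ?thesis by (simp add: algebra_simps)
    qed
    \<comment> \<open>If \<open>u s\<close> vanished, \<open>y\<close> would be a unimodular multiple of \<open>x\<close>, and the two values would agree.\<close>
    have nz: "u s \<noteq> 0" for s
    proof
      assume u0: "u s = 0"
      have "s \<noteq> 0" using u0 x(1) c(1) by (auto simp: u_def dest: arg_cong[where f = norm])
      have "s *\<^sub>R y = (- (of_real (1 - s) * c)) *\<^sub>C x"
        using u0 unfolding complex_vector.scale_minus_left
        by (simp only: u_def scaleR_eq_scaleC scaleC_scaleC add_eq_0_iff)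
      then have "inverse s *\<^sub>R (s *\<^sub>R y) = (of_real (inverse s) * (- (of_real (1 - s) * c))) *\<^sub>C x"
        by (simp only: scaleR_eq_scaleC scaleC_scaleC)
      then obtain r where r: "y = r *\<^sub>C x"
        unfolding scaleR_scaleR left_inverse[OF \<open>s \<noteq> 0\<close>] scaleR_one by blast
      then have "cmod r = 1" using x(1) y(1) by simp
      then have "cnj r * r = 1" by (simp add: complex_norm_square[symmetric] mult.commute)
      moreover have "b = cnj r * r * a" using x(2) y(2) unfolding r by (simp add: AC cinner_simps mult_ac)
      ultimately have "b = a" by simp
      then show False using False by simp
    qed
    define f where "f s = ((1 - s) * s * k + s\<^sup>2) / (norm (u s))\<^sup>2" for s
    have "continuous_on {0..1} f"
      unfolding f_def using nz unfolding u_def by (intro continuous_intros) auto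
    moreover have "f 0 = 0" "f 1 = 1" using y(1) by (simp_all add: f_def u_def)
    ultimately obtain s where s: "f s = t" using IVT'[of f 0 t 1] t by auto
    define w where "w = inverse (norm (u s)) *\<^sub>R u s"
    have "norm w = 1" using nz by (simp add: w_def)
    moreover have "cinner (A w) w = l *\<^sub>R a + t *\<^sub>R b"
    proof -
      define n where "n = (norm (u s))\<^sup>2"
      have n: "n \<noteq> 0" using nz by (simp add: n_def)
      have st: "(1 - s) * s * k + s\<^sup>2 = t * n" using s n by (simp add: f_def n_def field_simps)
      have "cinner (A w) w = cinner (A (u s)) (u s) / of_real n"
        by (simp add: w_def A.scaleR cinner_simps n_def power2_eq_square divide_simps)
      also have "cinner (A (u s)) (u s) = a * of_real n + d * of_real (t * n)"
        using form[of s] unfolding st cinner_self n_def[symmetric] by (simp add: algebra_simps)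
      also have "\<dots> / of_real n = a + of_real t * d" using n by (simp add: field_simps)
      finally show ?thesis by (simp add: l d_def scaleR_conv_of_real algebra_simps)
    qed
    ultimately show ?thesis unfolding numerical_range_def by (intro CollectI exI[of _ w]) simp
  qed
qed

text \<open>Each point of the disk lies on the vertical chord through it.\<close>

lemma cball_subset_of_convex_containing_circle:
  assumes "convex W" "sphere 0 1 \<subseteq> W"
  shows "cball (0::complex) 1 \<subseteq> W"
proof
  fix w :: complex assume "w \<in> cball 0 1"
  then have "(Re w)\<^sup>2 + (Im w)\<^sup>2 \<le> 1" by (simp add: cmod_def)
  define h where "h = sqrt (1 - (Re w)\<^sup>2)"
  have h: "h\<^sup>2 = 1 - (Re w)\<^sup>2" "0 \<le> h"
    using \<open>(Re w)\<^sup>2 + (Im w)\<^sup>2 \<le> 1\<close> by (simp_all add: h_def) (smt (verit) zero_le_power2)+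
  have "\<bar>Im w\<bar> \<le> h" using h \<open>(Re w)\<^sup>2 + (Im w)\<^sup>2 \<le> 1\<close> abs_le_square_iff[of "Im w" h] by simp
  have "Complex (Re w) h \<in> W" "Complex (Re w) (- h) \<in> W" using assms(2) h by (auto simp: cmod_def)
  moreover have "w \<in> closed_segment (Complex (Re w) (- h)) (Complex (Re w) h)"
    unfolding closed_segment_same_Re using \<open>\<bar>Im w\<bar> \<le> h\<close>
    by (subst closed_segment_same_Re) (auto simp: closed_segment_eq_real_ivl)
  ultimately show "w \<in> W" using assms(1) convex_contains_segment by blast
qed

section \<open>Points of the numerical range on the unit circle\<close>

text \<open>This is \<open>I - Re (cnj z A)\<close>. For unimodular \<open>z\<close> it is positive exactly if the numerical range lies in the
half plane that contains the unit disk and touches it at \<open>z\<close>.\<close>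

definition gap_operator :: "('a::complex_hilbert \<Rightarrow> 'a) \<Rightarrow> complex \<Rightarrow> 'a \<Rightarrow> 'a" where
  "gap_operator A z x = x + (- cnj z / 2) *\<^sub>C A x + (- z / 2) *\<^sub>C cadjoint A x"

lemma bounded_clinear_gap_operator: "bounded_clinear A \<Longrightarrow> bounded_clinear (gap_operator A z)"
  unfolding gap_operator_def
  by (intro bounded_clinear_add bounded_clinear_scale bounded_clinear_id bounded_clinear_cadjoint)

lemma gap_operator_symmetric:
  assumes "bounded_clinear A"
  shows "cinner (gap_operator A z x) y = cinner x (gap_operator A z y)"
  by (simp add: gap_operator_def cinner_simps cadjoint_works[OF assms] cinner_cadjoint_left[OF assms])

lemma inner_gap_operator:
  assumes "bounded_clinear A"
  shows "inner (gap_operator A z x) x = (norm x)\<^sup>2 - Re (cnj z * cinner (A x) x)"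
proof -
  have "cinner (cadjoint A x) x = cnj (cinner (A x) x)"
    by (metis cinner_cadjoint_left[OF assms] cinner_commute)
  then show ?thesis by (simp add: inner_eq_Re_cinner gap_operator_def cinner_simps cinner_self)
qed

lemma gap_operator_nonneg:
  assumes "bounded_clinear A" "numerical_range A \<subseteq> cball 0 1" "cmod z = 1"
  shows "0 \<le> inner (gap_operator A z x) x"
  using complex_Re_le_cmod[of "cnj z * cinner (A x) x"] cinner_le_of_numerical_range[OF assms(1,2), of x]
  by (simp add: inner_gap_operator[OF assms(1)] norm_mult assms(3))

lemma norm_gap_operator_squared_le:
  assumes "bounded_clinear A" "numerical_range A \<subseteq> cball 0 1" "cmod z = 1"
  obtains C where "0 < C" "\<And>x. (norm (gap_operator A z x))\<^sup>2 \<le> C * inner (gap_operator A z x) x"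
proof -
  have lin: "bounded_linear (gap_operator A z)"
    by (rule bounded_clinear_bounded_linear[OF bounded_clinear_gap_operator[OF assms(1)]])
  obtain C where C: "1 \<le> C" "\<And>x. norm (gap_operator A z x) \<le> C * norm x"
    using bounded_linear_bound_ge_one[OF lin] by blast
  have "(norm (gap_operator A z x))\<^sup>2 \<le> C * inner (gap_operator A z x) x" for x
    using C by (intro semidefinite_norm_bound[OF lin] gap_operator_nonneg[OF assms])
      (auto simp: inner_eq_Re_cinner gap_operator_symmetric[OF assms(1)])
  then show thesis using that[of C] C(1) by simp
qed

text \<open>For a unit vector \<open>x\<close>, the number \<open>cnj z \<langle>A x, x\<rangle>\<close> has modulus at most \<open>1\<close>, so its real part equals \<open>1\<close>
only if the number itself does. For a positive operator the vanishing of the quadratic form at \<open>x\<close> means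
that \<open>x\<close> lies in the kernel.\<close>

lemma unimodular_in_numerical_range_iff:
  fixes A :: "'a::complex_hilbert \<Rightarrow> 'a"
  assumes A: "bounded_clinear A" and W: "numerical_range A \<subseteq> cball 0 1" and z: "cmod z = 1"
  shows "z \<in> numerical_range A \<longleftrightarrow> (\<exists>x. x \<noteq> 0 \<and> gap_operator A z x = 0)"
proof
  assume "z \<in> numerical_range A"
  then obtain x where x: "norm x = 1" "cinner (A x) x = z" by (auto simp: numerical_range_def)
  have "cnj z * z = 1" using z by (simp add: complex_norm_square[symmetric] mult.commute)
  then have "inner (gap_operator A z x) x = 0" by (simp add: inner_gap_operator[OF A] x)
  then have "gap_operator A z x = 0"
    using norm_gap_operator_squared_le[OF A W z] by (metis mult_zero_right power2_less_eq_zero_iff norm_eq_zero)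
  then show "\<exists>x. x \<noteq> 0 \<and> gap_operator A z x = 0" using x(1) by (intro exI[of _ x]) auto
next
  assume "\<exists>x. x \<noteq> 0 \<and> gap_operator A z x = 0"
  then obtain x0 where x0: "x0 \<noteq> 0" "gap_operator A z x0 = 0" by blast
  define x where "x = inverse (norm x0) *\<^sub>R x0"
  have x: "norm x = 1" using x0 by (simp add: x_def)
  have lin: "bounded_linear (gap_operator A z)"
    by (rule bounded_clinear_bounded_linear[OF bounded_clinear_gap_operator[OF A]])
  have "gap_operator A z x = 0" by (simp add: x_def linear_simps(5)[OF lin] x0)
  then have Re1: "Re (cnj z * cinner (A x) x) = 1"
    using inner_gap_operator[OF A, of z x] x by simp
  moreover have "cmod (cnj z * cinner (A x) x) \<le> 1"
    using cinner_le_of_numerical_range[OF A W, of x] x by (simp add: norm_mult z)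
  ultimately have "Im (cnj z * cinner (A x) x) = 0"
    using cmod_power2[of "cnj z * cinner (A x) x"] power_mono[of "cmod (cnj z * cinner (A x) x)" 1 2] by simp
  then have "cnj z * cinner (A x) x = 1" using Re1 by (simp only: complex_eq_iff one_complex.sel)
  then have "z * cnj z * cinner (A x) x = z" by (simp add: mult.assoc)
  then have "cinner (A x) x = z" using z by (simp add: complex_norm_square[symmetric])
  then show "z \<in> numerical_range A" using x by (auto simp: numerical_range_def)
qed

lemma bounded_clinear_zero: "bounded_clinear (\<lambda>x. 0)"
  by (simp add: bounded_clinear_def bounded_linear_zero)

lemma bounded_clinear_sum:
  assumes "\<And>i. i \<in> I \<Longrightarrow> bounded_clinear (f i)"
  shows "bounded_clinear (\<lambda>x. \<Sum>i\<in>I. f i x)"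
  using assms
  by (induction I rule: infinite_finite_induct) (simp_all add: bounded_clinear_zero bounded_clinear_add)

lemma bounded_clinear_rank_one: "bounded_clinear (\<lambda>x. cinner x e *\<^sub>C e)"
proof (rule bounded_clinearI[of _ "norm e * norm e"])
  show "norm (cinner x e *\<^sub>C e) \<le> norm x * (norm e * norm e)" for x
    using mult_right_mono[OF cinner_Cauchy_Schwarz, of "norm e" x e] by (simp add: mult.assoc)
qed (simp_all add: cinner_add_left scaleC_add_left cinner_scaleC_left scaleC_scaleC)

text \<open>The finite-rank operator that makes the gap operator coercive. Its quadratic form is the sum of the squares
\<open>\<bar>\<langle>x, e i\<rangle>\<bar>\<^sup>2\<close>.\<close>

definition frame_operator :: "nat \<Rightarrow> (nat \<Rightarrow> 'a::complex_hilbert) \<Rightarrow> 'a \<Rightarrow> 'a" where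
  "frame_operator n e x = (\<Sum>i<n. cinner x (e i) *\<^sub>C e i)"

lemma bounded_clinear_frame_operator: "bounded_clinear (frame_operator n e)"
  unfolding frame_operator_def by (intro bounded_clinear_sum bounded_clinear_rank_one)

lemma inner_frame_operator: "inner (frame_operator n e x) x = (\<Sum>i<n. (cmod (cinner x (e i)))\<^sup>2)"
proof -
  have "cinner (frame_operator n e x) x = (\<Sum>i<n. cinner x (e i) * cnj (cinner x (e i)))"
    by (simp add: frame_operator_def cinner_sum_left cinner_scaleC_left flip: cinner_commute)
  then show ?thesis by (simp add: inner_eq_Re_cinner complex_norm_square[symmetric])
qed

lemma coercive_bounded_below:
  fixes R :: "'a::real_inner \<Rightarrow> 'a"
  assumes "\<kappa> * (norm x)\<^sup>2 \<le> inner (R x) x"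
  shows "\<kappa> * norm x \<le> norm (R x)"
proof (cases "x = 0")
  case False
  have "\<kappa> * norm x * norm x \<le> norm (R x) * norm x"
    using order_trans[OF assms norm_cauchy_schwarz] by (simp add: power2_eq_square)
  then show ?thesis using False by simp
qed simp

lemma compact_bounded_combinations:
  fixes u :: "nat \<Rightarrow> 'a::complex_hilbert"
  shows "compact {\<Sum>i<n. c i *\<^sub>C u i | c. \<forall>i<n. cmod (c i) \<le> 1}"
proof (induction n)
  case 0
  have "{\<Sum>i<0. c i *\<^sub>C u i | c. \<forall>i<0. cmod (c i) \<le> 1} = {0}" by auto
  then show ?case by simp
next
  case (Suc n)
  let ?C = "\<lambda>n. {\<Sum>i<n. c i *\<^sub>C u i | c. \<forall>i<n. cmod (c i) \<le> 1}"
  have "?C (Suc n) \<subseteq> (\<lambda>(s, b). s + b *\<^sub>C u n) ` (?C n \<times> cball 0 1)"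
  proof clarify
    fix c :: "nat \<Rightarrow> complex" assume "\<forall>i<Suc n. cmod (c i) \<le> 1"
    then have "(\<Sum>i<n. c i *\<^sub>C u i, c n) \<in> ?C n \<times> cball 0 1" by auto
    then show "(\<Sum>i<Suc n. c i *\<^sub>C u i) \<in> (\<lambda>(s, b). s + b *\<^sub>C u n) ` (?C n \<times> cball 0 1)"
      by (rule rev_image_eqI) simp
  qed
  moreover have "(\<lambda>(s, b). s + b *\<^sub>C u n) ` (?C n \<times> cball 0 1) \<subseteq> ?C (Suc n)"
  proof clarsimp
    fix c :: "nat \<Rightarrow> complex" and b :: complex
    assume "\<forall>i<n. cmod (c i) \<le> 1" "cmod b \<le> 1"
    then show "\<exists>d. (\<Sum>i<n. c i *\<^sub>C u i) + b *\<^sub>C u n = (\<Sum>i<n. d i *\<^sub>C u i) + d n *\<^sub>C u n \<and>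
        (\<forall>i<Suc n. cmod (d i) \<le> 1)"
      by (intro exI[of _ "\<lambda>i. if i = n then b else c i"]) auto
  qed
  ultimately have "?C (Suc n) = (\<lambda>(s, b). s + b *\<^sub>C u n) ` (?C n \<times> cball 0 1)" by (rule equalityI)
  moreover have "compact ((\<lambda>(s, b). s + b *\<^sub>C u n) ` (?C n \<times> cball 0 1))"
    unfolding case_prod_unfold
    by (intro compact_continuous_image compact_Times Suc.IH compact_cball continuous_intros
        bounded_linear.continuous_on[OF bounded_linear_scaleC_left])
  ultimately show ?case by simp
qed

text \<open>Let the values at unit vectors \<open>x k\<close> tend to \<open>z\<close>. Then the gap operator sends \<open>x k\<close> to vectors that tend to
\<open>0\<close>. Adding the frame operator gives an operator with bounded inverse \<open>U\<close>, and it follows that \<open>x k\<close> is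
asymptotic to \<open>\<Sum>i. \<langle>x k, e i\<rangle> U (e i)\<close>. These vectors stay in a compact set, so a subsequence of \<open>x k\<close>
converges in norm to a unit vector in the kernel.\<close>

lemma unimodular_closure_numerical_range_attained:
  fixes A :: "'a::complex_hilbert \<Rightarrow> 'a" and e :: "nat \<Rightarrow> 'a"
  assumes A: "bounded_clinear A" and W: "numerical_range A \<subseteq> cball 0 1" and z: "cmod z = 1"
    and cl: "z \<in> closure (numerical_range A)"
    and \<kappa>: "0 < \<kappa>" and e1: "\<And>i. i < n \<Longrightarrow> norm (e i) = 1"
    and coer: "\<And>x. \<kappa> * (norm x)\<^sup>2 \<le> inner (gap_operator A z x) x + (\<Sum>i<n. (cmod (cinner x (e i)))\<^sup>2)"
  shows "z \<in> numerical_range A"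
proof -
  define M where "M = gap_operator A z"
  define R where "R x = M x + frame_operator n e x" for x
  have Mc: "bounded_clinear M" unfolding M_def by (rule bounded_clinear_gap_operator[OF A])
  have Rc: "bounded_clinear R"
    unfolding R_def by (intro bounded_clinear_add Mc bounded_clinear_frame_operator)
  interpret M: bounded_linear M by (rule bounded_clinear_bounded_linear[OF Mc])
  interpret R: bounded_linear R by (rule bounded_clinear_bounded_linear[OF Rc])
  have Rcoer: "\<kappa> * (norm x)\<^sup>2 \<le> inner (R x) x" for x
    using coer[of x] by (simp add: R_def M_def inner_add_left inner_frame_operator)
  obtain U where RU: "\<And>y. R (U y) = y"
    using coercive_surjective[OF R.bounded_linear_axioms \<kappa> Rcoer] by metis
  obtain C where C: "0 < C" "\<And>x. (norm (M x))\<^sup>2 \<le> C * inner (M x) x"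
    unfolding M_def using norm_gap_operator_squared_le[OF A W z] by blast
  obtain a where a: "\<And>k. a k \<in> numerical_range A" "a \<longlonglongrightarrow> z"
    using cl unfolding closure_sequential by blast
  have "\<exists>x. norm x = 1 \<and> cinner (A x) x = a k" for k
    using a(1)[of k] by (auto simp: numerical_range_def)
  then obtain x where x: "\<And>k. norm (x k) = 1" "\<And>k. cinner (A (x k)) (x k) = a k" by metis
  have zz: "cnj z * z = 1" using z by (simp add: complex_norm_square[symmetric] mult.commute)
  have "(\<lambda>k. C * (1 - Re (cnj z * a k))) \<longlonglongrightarrow> C * (1 - Re (cnj z * z))"
    by (intro tendsto_intros a)
  then have "(\<lambda>k. C * (1 - Re (cnj z * a k))) \<longlonglongrightarrow> 0" by (simp add: zz)
  then have "(\<lambda>k. (norm (M (x k)))\<^sup>2) \<longlonglongrightarrow> 0"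
  proof (rule Lim_null_comparison[rotated], intro always_eventually allI)
    show "norm ((norm (M (x k)))\<^sup>2) \<le> C * (1 - Re (cnj z * a k))" for k
      using C(2)[of "x k"] by (simp add: M_def inner_gap_operator[OF A] x)
  qed
  then have Mx: "(\<lambda>k. norm (M (x k))) \<longlonglongrightarrow> 0"
    using tendsto_real_sqrt[of "\<lambda>k. (norm (M (x k)))\<^sup>2" 0 sequentially] by simp
  define u where "u i = U (e i)" for i
  define p where "p k = (\<Sum>i<n. cinner (x k) (e i) *\<^sub>C u i)" for k
  have "R (x k - p k) = M (x k)" for k
    by (simp add: R.diff p_def R.sum bounded_clinear_scaleC[OF Rc] u_def RU) (simp add: R_def frame_operator_def)
  then have xp: "\<kappa> * norm (x k - p k) \<le> norm (M (x k))" for k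
    using coercive_bounded_below[where R = R and x = "x k - p k", OF Rcoer] by simp
  have "(\<lambda>k. x k - p k) \<longlonglongrightarrow> 0"
  proof (rule Lim_null_comparison[of _ "\<lambda>k. norm (M (x k)) / \<kappa>"], intro always_eventually allI)
    show "norm (x k - p k) \<le> norm (M (x k)) / \<kappa>" for k using xp[of k] \<kappa> by (simp add: field_simps)
    show "(\<lambda>k. norm (M (x k)) / \<kappa>) \<longlonglongrightarrow> 0" using tendsto_divide[OF Mx tendsto_const[of \<kappa>]] \<kappa> by simp
  qed
  have pC: "p k \<in> {\<Sum>i<n. c i *\<^sub>C u i | c. \<forall>i<n. cmod (c i) \<le> 1}" for k
  proof -
    have "cmod (cinner (x k) (e i)) \<le> 1" if "i < n" for i
      using cinner_Cauchy_Schwarz[of "x k" "e i"] x(1) e1[OF that] by simp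
    then show ?thesis unfolding p_def by (intro CollectI exI[of _ "\<lambda>i. cinner (x k) (e i)"]) auto
  qed
  obtain l r where r: "strict_mono (r :: nat \<Rightarrow> nat)" "(p \<circ> r) \<longlonglongrightarrow> l"
    using compact_bounded_combinations[where n=n and u=u] pC unfolding compact_def by blast
  have "((\<lambda>k. x k - p k) \<circ> r) \<longlonglongrightarrow> 0" by (rule LIMSEQ_subseq_LIMSEQ[OF \<open>(\<lambda>k. x k - p k) \<longlonglongrightarrow> 0\<close> r(1)])
  from tendsto_add[OF this r(2)] have xl: "(\<lambda>k. x (r k)) \<longlonglongrightarrow> l" by (simp add: o_def)
  have "(\<lambda>k. norm (x (r k))) \<longlonglongrightarrow> 1" by (simp add: x(1))
  from LIMSEQ_unique[OF tendsto_norm[OF xl] this] have "norm l = 1" .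
  moreover have "M l = 0"
  proof -
    have M0: "(\<lambda>k. norm (M (x (r k)))) \<longlonglongrightarrow> 0" using LIMSEQ_subseq_LIMSEQ[OF Mx r(1)] by (simp add: o_def)
    show ?thesis using LIMSEQ_unique[OF tendsto_norm[OF M.tendsto[OF xl]] M0] by simp
  qed
  moreover have "l \<noteq> 0" using \<open>norm l = 1\<close> by auto
  ultimately show ?thesis
    unfolding unimodular_in_numerical_range_iff[OF A W z] M_def by blast
qed

text \<open>On the unit circle \<open>cnj w = 1 / w\<close>, hence \<open>w\<close> times the gap operator at \<open>w\<close> is
\<open>w - (A + w\<^sup>2 A\<^sup>*) / 2\<close>, which is a polynomial in \<open>w\<close> and makes sense off the circle. The factor \<open>cnj z\<close>
normalises it to be the gap operator at \<open>w = z\<close>. After adding the frame operator it is coercive at \<open>z\<close>, hence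
near \<open>z\<close>, and its inverse is holomorphic there. Removing the frame operator again creates a kernel exactly at
the zeros of a finite determinant with holomorphic entries.\<close>

lemma unimodular_numerical_range_locally_zero_set:
  fixes A :: "'a::complex_hilbert \<Rightarrow> 'a" and e :: "nat \<Rightarrow> 'a"
  assumes A: "bounded_clinear A" and W: "numerical_range A \<subseteq> cball 0 1" and z: "cmod z = 1"
    and \<kappa>: "0 < \<kappa>"
    and coer: "\<And>x. \<kappa> * (norm x)\<^sup>2 \<le> inner (gap_operator A z x) x + (\<Sum>i<n. (cmod (cinner x (e i)))\<^sup>2)"
  obtains r d where "0 < r" "d holomorphic_on ball z r"
    "\<And>w. w \<in> ball z r \<inter> sphere 0 1 \<Longrightarrow> w \<in> numerical_range A \<longleftrightarrow> d w = 0"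
proof -
  define S where "S = frame_operator n e"
  define L0 where "L0 x = (- cnj z / 2) *\<^sub>C A x + S x" for x
  define L1 where "L1 x = cnj z *\<^sub>C x" for x :: 'a
  define L2 where "L2 x = (- cnj z / 2) *\<^sub>C cadjoint A x" for x
  define R where "R w x = L0 x + w *\<^sub>C L1 x + w\<^sup>2 *\<^sub>C L2 x" for w x
  have L: "bounded_clinear L0" "bounded_clinear L1" "bounded_clinear L2"
    unfolding L0_def L1_def L2_def S_def
    by (intro bounded_clinear_add bounded_clinear_scale bounded_clinear_id bounded_clinear_cadjoint
        bounded_clinear_frame_operator A)+
  have Rc: "bounded_clinear (R w)" for w
    unfolding R_def by (intro bounded_clinear_add bounded_clinear_scale L)
  have zz: "cnj z * z = 1" using z by (simp add: complex_norm_square[symmetric] mult.commute)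
  have Rgap: "R w x = (cnj z * w) *\<^sub>C gap_operator A w x + S x" if w: "cmod w = 1" for w x
  proof -
    have ww: "w * cnj w = 1" using w by (simp add: complex_norm_square[symmetric])
    have "(cnj z * w) *\<^sub>C gap_operator A w x =
        (cnj z * w) *\<^sub>C x + (- (w * cnj w) * cnj z / 2) *\<^sub>C A x + (- cnj z / 2 * w\<^sup>2) *\<^sub>C cadjoint A x"
      by (simp add: gap_operator_def scaleC_add_right complex_vector.scale_right_diff_distrib
          scaleC_scaleC power2_eq_square mult_ac)
    then show ?thesis
      by (simp add: R_def L0_def L1_def L2_def scaleC_scaleC ww mult_ac)
  qed
  have Rz: "R z x = gap_operator A z x + S x" for x
    using Rgap[OF z, of x] by (simp add: zz scaleC_one)
  have Rzcoer: "\<kappa> * (norm x)\<^sup>2 \<le> inner (R z x) x" for x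
    using coer[of x] by (simp add: Rz S_def inner_add_left inner_frame_operator)
  obtain C where C: "1 \<le> C" "\<And>x. norm (L2 x) \<le> C * norm x"
    using bounded_linear_bound_ge_one[OF bounded_clinear_bounded_linear[OF L(3)]] by blast
  \<comment> \<open>\<open>(1 + 3 C) \<bar>w - z\<bar>\<close> bounds the norm of \<open>R w - R z\<close>, because \<open>\<bar>w + z\<bar> \<le> 3\<close>; half of the coercivity
    constant has to survive.\<close>
  define r where "r = min 1 (\<kappa> / (2 * (1 + 3 * C)))"
  have r: "0 < r" "r \<le> 1" "r * (1 + 3 * C) \<le> \<kappa> / 2"
  proof -
    show "0 < r" "r \<le> 1" using \<kappa> C(1) by (auto simp: r_def)
    have "r * (1 + 3 * C) \<le> \<kappa> / (2 * (1 + 3 * C)) * (1 + 3 * C)"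
      using C(1) by (intro mult_right_mono) (auto simp: r_def)
    also have "\<dots> = \<kappa> / 2" using C(1) nonzero_mult_div_cancel_right[of "1 + 3 * C" "\<kappa> / 2"] by simp
    finally show "r * (1 + 3 * C) \<le> \<kappa> / 2" .
  qed
  have Rcoer: "\<kappa>/2 * (norm x)\<^sup>2 \<le> inner (R w x) x" if w: "w \<in> ball z r" for w x
  proof -
    have wz: "cmod (w - z) \<le> r" using w by (simp add: dist_norm norm_minus_commute)
    have "cmod (w + z) = cmod ((w - z) + 2 * z)" by (simp add: algebra_simps)
    also have "\<dots> \<le> cmod (w - z) + cmod (2 * z)" by (rule norm_triangle_ineq)
    finally have wz3: "cmod (w + z) \<le> 3" using wz r z by (simp add: norm_mult)
    have dec: "R w x - R z x = (w - z) *\<^sub>C (L1 x + (w + z) *\<^sub>C L2 x)"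
      unfolding R_def
      by (simp add: scaleC_add_right scaleC_scaleC algebra_simps power2_eq_square
          complex_vector.scale_left_diff_distrib)
    have "norm (L1 x + (w + z) *\<^sub>C L2 x) \<le> norm (L1 x) + cmod (w + z) * norm (L2 x)"
      using norm_triangle_ineq[of "L1 x" "(w + z) *\<^sub>C L2 x"] by simp
    also have "\<dots> \<le> norm x + 3 * (C * norm x)"
      using wz3 C by (intro add_mono mult_mono) (auto simp: L1_def z)
    finally have "cmod (w - z) * norm (L1 x + (w + z) *\<^sub>C L2 x) \<le> r * (norm x + 3 * (C * norm x))"
      using wz r by (intro mult_mono) auto
    also have "\<dots> = r * (1 + 3 * C) * norm x" by (simp add: algebra_simps)
    also have "\<dots> \<le> \<kappa>/2 * norm x" using r(3) by (intro mult_right_mono) auto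
    finally have "norm (R w x - R z x) \<le> \<kappa>/2 * norm x" by (simp add: dec)
    then have "norm (R w x - R z x) * norm x \<le> \<kappa>/2 * norm x * norm x" by (intro mult_right_mono) auto
    then have "\<bar>inner (R w x - R z x) x\<bar> \<le> \<kappa>/2 * (norm x)\<^sup>2"
      using Cauchy_Schwarz_ineq2[of "R w x - R z x" x] by (simp add: power2_eq_square)
    then have "- (\<kappa>/2 * (norm x)\<^sup>2) \<le> inner (R w x) x - inner (R z x) x"
      unfolding inner_diff_left by linarith
    then show ?thesis using Rzcoer[of x] by simp
  qed
  have \<kappa>2: "0 < \<kappa>/2" using \<kappa> by simp
  have "\<exists>x. R w x = y" if "w \<in> ball z r" for w y
    by (rule coercive_surjective[OF bounded_clinear_bounded_linear[OF Rc] \<kappa>2 Rcoer[OF that]])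
  then obtain U where RU: "\<And>w y. w \<in> ball z r \<Longrightarrow> R w (U w y) = y" by metis
  have below: "\<kappa>/2 * norm x \<le> norm (R w x)" if "w \<in> ball z r" for w x
    by (rule coercive_bounded_below[where R = "R w", OF Rcoer[OF that]])
  define d where "d w = det (mat n n (\<lambda>(i, j). (if i = j then 1 else 0) - cinner (U w (e j)) (e i)))" for w
  have "(\<lambda>w. cinner (U w a) b) holomorphic_on ball z r" for a b
    by (rule holomorphic_inverse_of_quadratic_pencil[OF open_ball L \<kappa>2])
      (use below RU in \<open>auto simp: R_def\<close>)
  then have "d holomorphic_on ball z r"
    unfolding d_def by (intro holomorphic_on_det holomorphic_intros)
  moreover have "w \<in> numerical_range A \<longleftrightarrow> d w = 0" if w: "w \<in> ball z r \<inter> sphere 0 1" for w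
  proof -
    have w1: "cmod w = 1" and wb: "w \<in> ball z r" using w by auto
    have "d w = 0 \<longleftrightarrow> (\<exists>x. x \<noteq> 0 \<and> R w x = (\<Sum>i<n. cinner x (e i) *\<^sub>C e i))"
      unfolding d_def
    proof (rule kernel_iff_det_eq_zero[OF Rc, symmetric])
      show "x = 0" if "R w x = 0" for x
        using below[OF wb, of x] that \<kappa> by (simp add: mult_le_0_iff)
    qed (rule RU[OF wb])
    also have "\<dots> \<longleftrightarrow> (\<exists>x. x \<noteq> 0 \<and> (cnj z * w) *\<^sub>C gap_operator A w x = 0)"
      by (simp add: Rgap[OF w1] S_def frame_operator_def)
    also have "\<dots> \<longleftrightarrow> (\<exists>x. x \<noteq> 0 \<and> gap_operator A w x = 0)"
    proof -
      have "cnj z * w \<noteq> 0" using z w1 by auto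
      then show ?thesis by simp
    qed
    also have "\<dots> \<longleftrightarrow> w \<in> numerical_range A"
      by (rule unimodular_in_numerical_range_iff[OF A W w1, symmetric])
    finally show ?thesis by simp
  qed
  ultimately show thesis using that[OF r(1)] by blast
qed

section \<open>Propagation along the circle\<close>

text \<open>The set \<open>D\<close> of accumulation points of \<open>Z\<close> in \<open>C\<close> is nonempty by compactness and relatively closed. It is
relatively open: near an accumulation point the holomorphic function that defines \<open>Z\<close> vanishes identically,
so \<open>Z\<close> contains a neighbourhood in \<open>C\<close>, and \<open>C\<close> has no isolated points.\<close>

lemma locally_zero_set_infinite_imp_everything:
  fixes C Z :: "complex set"
  assumes C: "compact C" "connected C" and ZC: "Z \<subseteq> C" and inf: "infinite Z"
    and loc: "\<And>z. z \<in> C \<Longrightarrow> \<exists>r d. 0 < r \<and> d holomorphic_on ball z r \<and>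
      (\<forall>w \<in> ball z r \<inter> C. w \<in> Z \<longleftrightarrow> d w = 0)"
  shows "Z = C"
proof -
  define D where "D = {z \<in> C. z islimpt Z}"
  have nbhd: "\<exists>r>0. ball z r \<inter> C \<subseteq> Z" if z: "z \<in> D" for z
  proof -
    have "z \<in> C" and lim: "z islimpt Z" using z by (auto simp: D_def)
    obtain r d where r: "0 < r" and d: "d holomorphic_on ball z r"
      and iff: "\<And>w. w \<in> ball z r \<inter> C \<Longrightarrow> w \<in> Z \<longleftrightarrow> d w = 0" using loc[OF \<open>z \<in> C\<close>] by blast
    have lim': "z islimpt Z \<inter> ball z r" by (rule islimpt_Int_eventually[OF lim eventually_at_in_open']) (simp_all add: r)
    have "d w = 0" if w: "w \<in> ball z r" for w
    proof (rule analytic_continuation[OF d open_ball connected_ball _ _ lim' _ w])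
      show "d v = 0" if "v \<in> Z \<inter> ball z r" for v using iff[of v] ZC that by blast
    qed (use r in auto)
    then have "ball z r \<inter> C \<subseteq> Z" using iff by blast
    then show ?thesis using r by blast
  qed
  have perfect: "z islimpt C" if "z \<in> C" for z
  proof (rule connected_imp_perfect[OF C(2) that])
    show "C \<noteq> {a}" for a using inf finite_subset[OF ZC] by auto
  qed
  have "openin (top_of_set C) D"
    unfolding openin_contains_ball
  proof (intro conjI ballI)
    fix z assume "z \<in> D"
    then obtain r where r: "0 < r" "ball z r \<inter> C \<subseteq> Z" using nbhd by blast
    have "ball z r \<inter> C \<subseteq> D"
    proof
      fix w assume w: "w \<in> ball z r \<inter> C"
      have "w islimpt C \<inter> ball z r" using w by (intro islimpt_Int_eventually perfect eventually_at_in_open') auto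
      then have "w islimpt Z" by (rule islimpt_subset) (use r in auto)
      then show "w \<in> D" using w by (simp add: D_def)
    qed
    then show "\<exists>e>0. ball z e \<inter> C \<subseteq> D" using r by blast
  qed (auto simp: D_def)
  moreover have "closedin (top_of_set C) D"
  proof -
    have "D = C \<inter> {z. z islimpt Z}" by (auto simp: D_def)
    then show ?thesis by (simp only: closedin_closed_Int closed_limpts)
  qed
  moreover have "D \<noteq> {}"
    using Heine_Borel_imp_Bolzano_Weierstrass[OF C(1) inf ZC] by (auto simp: D_def)
  ultimately have "D = C" using C(2)[unfolded connected_clopen, rule_format, of D] by simp
  have "z \<in> Z" if "z \<in> C" for z
  proof -
    have "z \<in> D" using that \<open>D = C\<close> by simp
    from nbhd[OF this] show ?thesis using that by auto
  qed
  then show ?thesis using ZC by blast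
qed

theorem theorem4:
  fixes A N K :: "'a::complex_hilbert \<Rightarrow> 'a"
  assumes "normal_operator N"
    and "compact_operator K"
    and "A = (\<lambda>x. N x + K x)"
    and "numerical_range A \<subseteq> cball 0 1"
    and "infinite (sphere 0 1 \<inter> closure (numerical_range A))"
    and "essential_spectrum A \<subseteq> ball 0 1"
  shows "numerical_range A = cball 0 1"
proof -
  note W = assms(4)
  have A: "bounded_clinear A"
    using assms(1,2) unfolding assms(3) normal_operator_def compact_operator_def
    by (intro bounded_clinear_add) auto
  have coer: "\<exists>(n::nat) e \<kappa>. 0 < \<kappa> \<and> (\<forall>i<n. norm (e i) = 1) \<and> (\<forall>x. \<kappa> * (norm x)\<^sup>2 \<le>
      inner (gap_operator A z x) x + (\<Sum>i<n. (cmod (cinner x (e i)))\<^sup>2))" if z: "cmod z = 1" for z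
  proof -
    obtain B \<delta> where B: "finite B" "0 < \<delta>"
      "\<And>x. \<forall>b\<in>B. inner x b = 0 \<Longrightarrow> \<delta> * (norm x)\<^sup>2 \<le> (norm x)\<^sup>2 - Re (cnj z * cinner (A x) x)"
      using real_part_gap_on_finite_codim[OF assms(1,2,3,6) z] by blast
    show ?thesis
      unfolding inner_gap_operator[OF A] by (rule coercive_after_finite_rank_perturbation[OF A W z B])
  qed
  define Z where "Z = sphere 0 1 \<inter> numerical_range A"
  have "sphere 0 1 \<inter> closure (numerical_range A) \<subseteq> Z"
  proof
    fix z assume "z \<in> sphere 0 1 \<inter> closure (numerical_range A)"
    then have z: "cmod z = 1" and cl: "z \<in> closure (numerical_range A)" by auto
    obtain n :: nat and e \<kappa> where "0 < \<kappa>" "\<And>i. i < n \<Longrightarrow> norm (e i) = 1" "\<And>x. \<kappa> * (norm x)\<^sup>2 \<le>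
      inner (gap_operator A z x) x + (\<Sum>i<n. (cmod (cinner x (e i)))\<^sup>2)" using coer[OF z] by blast
    from unimodular_closure_numerical_range_attained[OF A W z cl this] show "z \<in> Z" using z by (simp add: Z_def)
  qed
  then have inf: "infinite Z" using assms(5) finite_subset by blast
  have "Z = sphere 0 1"
  proof (rule locally_zero_set_infinite_imp_everything[OF compact_sphere _ _ inf])
    show "connected (sphere (0::complex) 1)" by (rule connected_sphere) simp
    show "Z \<subseteq> sphere 0 1" by (simp add: Z_def)
    fix z :: complex assume "z \<in> sphere 0 1"
    then have z: "cmod z = 1" by simp
    obtain n :: nat and e \<kappa> where k: "0 < \<kappa>" and co: "\<And>x. \<kappa> * (norm x)\<^sup>2 \<le>
      inner (gap_operator A z x) x + (\<Sum>i<n. (cmod (cinner x (e i)))\<^sup>2)" using coer[OF z] by blast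
    obtain r d where rd: "0 < r" "d holomorphic_on ball z r"
      and zero: "\<And>w. w \<in> ball z r \<inter> sphere 0 1 \<Longrightarrow> w \<in> numerical_range A \<longleftrightarrow> d w = 0"
      by (rule unimodular_numerical_range_locally_zero_set[OF A W z k co]) (rule that, blast+)
    have "\<forall>w \<in> ball z r \<inter> sphere 0 1. w \<in> Z \<longleftrightarrow> d w = 0"
    proof
      fix w assume w: "w \<in> ball z r \<inter> sphere 0 1"
      then have "w \<in> Z \<longleftrightarrow> w \<in> numerical_range A" by (simp add: Z_def)
      then show "w \<in> Z \<longleftrightarrow> d w = 0" using zero[OF w] by simp
    qed
    then show "\<exists>r d. 0 < r \<and> d holomorphic_on ball z r \<and>
        (\<forall>w \<in> ball z r \<inter> sphere 0 1. w \<in> Z \<longleftrightarrow> d w = 0)"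
      by (intro exI[of _ r] exI[of _ d] conjI rd)
  qed
  then have "sphere 0 1 \<subseteq> numerical_range A" by (auto simp: Z_def)
  then show ?thesis
    using cball_subset_of_convex_containing_circle[OF convex_numerical_range[OF A]] W by blast
qed

end
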